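(* Let $z=(z_1,z_2)$ denote a point of $\mathbb{H}^2$ with $z_k=x_k+iy_k$ ($k=1,2$). If $z\in\mathcal{S}_5\cap\mathcal{T}$, then $y_1y_2\geq \sqrt{5}/4$. Consequently the same inequality holds for every $z\in\mathcal{F}_5$, and for $z\in\mathcal{F}_5$ equality $y_1y_2=\sqrt5/4$ holds if and only if $z$ is fixed by a totally elliptic element of $\Gamma_{\mathbb{Q}(\sqrt5)}$ represented by a matrix of trace $\varepsilon$ or $\varepsilon^{-1}$, where $\varepsilon=\frac{1+\sqrt5}{2}$. There are only finitely many points in $\mathcal{F}_5$ with this property.
   Context: Let $K=\mathbb{Q}(\sqrt5)\subset\mathbb{R}$ (with $\sqrt5>0$), let $\mathcal{O}_K=\{n+m\frac{1+\sqrt5}{2}: n,m\in\mathbb{Z}\}$ be its ring of integers, and let $\nu\mapsto\nu'$ denote the nontrivial conjugation of $K$. Put $\varepsilon=\frac{1+\sqrt5}{2}$, the fundamental unit greater than $1$. $\mathbb{H}$ is the complex upper half-plane. The Hilbert modular group $\Gamma_K$ is the set of pairs $\left(\begin{bmatrix}a&b\\c&d\end{bmatrix},\begin{bmatrix}a'&b'\\c'&d'\end{bmatrix}\right)$ with $\begin{bmatrix}a&b\\c&d\end{bmatrix}\in PSL(2,\mathcal{O}_K)$. Such an element is represented by its first coordinate, a $2\times2$ matrix of determinant $1$ with entries in $\mathcal{O}_K$ (determined up to sign). $\Gamma_K$ acts on $\mathbb{H}^2$ coordinate-wise by fractional linear transformations: $z_1\mapsto\frac{az_1+b}{cz_1+d}$,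 $z_2\mapsto\frac{a'z_2+b'}{c'z_2+d'}$. An element of $\Gamma_K$ is totally elliptic if the trace of each of its two coordinates has absolute value less than $2$. Define $\mathcal{U}_5=\{z\in\mathbb{H}^2:\varepsilon^{-2}\leq y_2/y_1<\varepsilon^2\}$ and $\mathcal{T}=\{z\in\mathbb{H}^2:|z_1z_2|\geq1\}$. The group $N_5$ of translations $(z_1,z_2)\mapsto(z_1+\nu,z_2+\nu')$, $\nu\in\mathcal{O}_K$, preserves $y_1$ and $y_2$. From each $N_5$-orbit in $\mathbb{H}^2$ choose exactly one point $z$ at which the function $|z_1z_2|$ restricted to that orbit takes its minimal value. $\mathcal{S}_5$ is the set of all chosen points (one point per orbit; the choice of minimizing point is arbitrary but fixed). Götzky's domain is $\mathcal{F}_5=\mathcal{U}_5\cap\mathcal{T}\cap\mathcal{S}_5$. *)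

theory Defs
  imports "HOL-Analysis.Analysis" "HOL-Computational_Algebra.Primes"
begin

section \<open>The field of rational numbers with the square root of 5 adjoined\<close>

definition \<epsilon> :: real where
  "\<epsilon> = (1 + sqrt 5) / 2"

definition K5 :: "real set" where
  "K5 = {p + q * sqrt 5 | p q. p \<in> \<rat> \<and> q \<in> \<rat>}"

definition O5 :: "real set" where
  "O5 = {of_int n + of_int m * \<epsilon> | n m. True}"

text \<open>The conjugation is meaningful on \<^const>\<open>K5\<close> only, where the description is unique
  because \<open>sqrt 5\<close> is irrational (see the lemma \<open>K5_conj_eq\<close>).\<close>

definition K5_conj :: "real \<Rightarrow> real" where
  "K5_conj x = (THE y. \<exists>p q. p \<in> \<rat> \<and> q \<in> \<rat> \<and> x = p + q * sqrt 5 \<and> y = p - q * sqrt 5)"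

lemma sqrt_5_irrational: "sqrt 5 \<notin> \<rat>"
proof
  assume "sqrt 5 \<in> \<rat>"
  then obtain m n :: nat where n: "n \<noteq> 0" and s: "\<bar>sqrt 5\<bar> = m / n" and c: "coprime m n"
    by (rule Rats_abs_nat_div_natE)
  from s n have "real m = sqrt 5 * real n"
    by (simp add: field_simps)
  then have "(real m)\<^sup>2 = 5 * (real n)\<^sup>2"
    by (simp add: power_mult_distrib)
  then have "real (m\<^sup>2) = real (5 * n\<^sup>2)" by simp
  then have eq: "m\<^sup>2 = 5 * n\<^sup>2" by (rule of_nat_eq_iff[THEN iffD1])
  have p5: "prime (5 :: nat)" by simp
  from eq have "5 dvd m\<^sup>2" by simp
  with p5 have m: "5 dvd m" by (rule prime_dvd_power)
  then obtain k where "m = 5 * k" by (elim dvdE)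
  with eq have "n\<^sup>2 = 5 * k\<^sup>2" by (simp add: power_mult_distrib)
  then have "5 dvd n\<^sup>2" by simp
  with p5 have "5 dvd n" by (rule prime_dvd_power)
  with m have "5 dvd gcd m n" by simp
  with c show False by simp
qed

lemma K5_repr_unique:
  assumes "p \<in> \<rat>" "q \<in> \<rat>" "p' \<in> \<rat>" "q' \<in> \<rat>"
    and eq: "p + q * sqrt 5 = p' + q' * sqrt 5"
  shows "p = p' \<and> q = q'"
proof -
  have "q = q'"
  proof (rule ccontr)
    assume "q \<noteq> q'"
    with eq have "sqrt 5 = (p' - p) / (q - q')"
      by (simp add: field_simps)
    moreover have "(p' - p) / (q - q') \<in> \<rat>"
      using assms(1-4) by (intro Rats_divide Rats_diff)
    ultimately show False using sqrt_5_irrational by simp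
  qed
  with eq show ?thesis by simp
qed

lemma K5_conj_eq:
  assumes "p \<in> \<rat>" "q \<in> \<rat>"
  shows "K5_conj (p + q * sqrt 5) = p - q * sqrt 5"
  unfolding K5_conj_def
proof (rule the_equality)
  show "\<exists>p' q'. p' \<in> \<rat> \<and> q' \<in> \<rat> \<and> p + q * sqrt 5 = p' + q' * sqrt 5
      \<and> p - q * sqrt 5 = p' - q' * sqrt 5"
    using assms by blast
next
  fix y
  assume "\<exists>p' q'. p' \<in> \<rat> \<and> q' \<in> \<rat> \<and> p + q * sqrt 5 = p' + q' * sqrt 5
      \<and> y = p' - q' * sqrt 5"
  then show "y = p - q * sqrt 5"
    using K5_repr_unique assms by blast
qed

lemma K5_conj_O5: "K5_conj (of_int n + of_int m * \<epsilon>) = of_int n + of_int m * ((1 - sqrt 5) / 2)"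
proof -
  have "K5_conj (of_int n + of_int m * \<epsilon>)
      = K5_conj ((of_int n + of_int m / 2) + (of_int m / 2) * sqrt 5)"
    by (rule arg_cong[where f = K5_conj]) (simp add: \<epsilon>_def field_simps)
  also have "\<dots> = (of_int n + of_int m / 2) - (of_int m / 2) * sqrt 5"
    by (intro K5_conj_eq) auto
  finally show ?thesis by (simp add: field_simps)
qed

lemma O5_subset_K5: "O5 \<subseteq> K5"
proof
  fix x assume "x \<in> O5"
  then obtain n m :: int where "x = of_int n + of_int m * \<epsilon>" unfolding O5_def by blast
  then have "x = (of_int n + of_int m / 2) + (of_int m / 2) * sqrt 5"
    by (simp add: \<epsilon>_def field_simps)
  moreover have "of_int n + of_int m / 2 \<in> (\<rat> :: real set)" "of_int m / 2 \<in> (\<rat> :: real set)"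
    by auto
  ultimately show "x \<in> K5" unfolding K5_def by blast
qed


section \<open>The Hilbert modular group and its action\<close>

definition H2 :: "(complex \<times> complex) set" where
  "H2 = {z. Im (fst z) > 0 \<and> Im (snd z) > 0}"

type_synonym mat2 = "real^2^2"

definition SL2_O5 :: "mat2 set" where
  "SL2_O5 = {A. (\<forall>i j. A $ i $ j \<in> O5) \<and> det A = 1}"

definition sign_rel :: "(mat2 \<times> mat2) set" where
  "sign_rel = {(A, B). A \<in> SL2_O5 \<and> B \<in> SL2_O5 \<and> (B = A \<or> B = - A)}"

definition PSL2_O5 :: "mat2 set set" where
  "PSL2_O5 = SL2_O5 // sign_rel"

definition conj_mat :: "mat2 \<Rightarrow> mat2" where
  "conj_mat A = (\<chi> i j. K5_conj (A $ i $ j))"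

text \<open>An element of the Hilbert modular group is a pair of classes of matrices modulo sign. The
  matrices representing \<open>\<gamma>\<close> are the elements of \<open>fst \<gamma>\<close>.\<close>

definition Hilbert_modular_group :: "(mat2 set \<times> mat2 set) set" where
  "Hilbert_modular_group = {(X, conj_mat ` X) | X. X \<in> PSL2_O5}"

definition frac_lin :: "mat2 \<Rightarrow> complex \<Rightarrow> complex" where
  "frac_lin A w = (of_real (A $ 1 $ 1) * w + of_real (A $ 1 $ 2))
                / (of_real (A $ 2 $ 1) * w + of_real (A $ 2 $ 2))"

text \<open>The representatives chosen by \<open>SOME\<close> do not matter: see \<open>Hilbert_act_eq\<close>.\<close>

definition Hilbert_act ::
  "mat2 set \<times> mat2 set \<Rightarrow> complex \<times> complex \<Rightarrow> complex \<times> complex" where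
  "Hilbert_act \<gamma> z = (frac_lin (SOME A. A \<in> fst \<gamma>) (fst z), frac_lin (SOME A. A \<in> snd \<gamma>) (snd z))"

definition totally_elliptic :: "mat2 set \<times> mat2 set \<Rightarrow> bool" where
  "totally_elliptic \<gamma> \<longleftrightarrow>
     (\<forall>A \<in> fst \<gamma>. \<bar>trace A\<bar> < 2) \<and> (\<forall>A \<in> snd \<gamma>. \<bar>trace A\<bar> < 2)"

lemma O5_uminus: "x \<in> O5 \<Longrightarrow> - x \<in> O5"
proof -
  assume "x \<in> O5"
  then obtain n m :: int where "x = of_int n + of_int m * \<epsilon>" unfolding O5_def by blast
  then have "- x = of_int (- n) + of_int (- m) * \<epsilon>" by simp
  then show ?thesis unfolding O5_def by blast
qed

lemma K5_conj_uminus: "x \<in> O5 \<Longrightarrow> K5_conj (- x) = - K5_conj x"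
proof -
  assume "x \<in> O5"
  then obtain n m :: int where x: "x = of_int n + of_int m * \<epsilon>" unfolding O5_def by blast
  have "- x = of_int (- n) + of_int (- m) * \<epsilon>" by (simp add: x)
  then have "K5_conj (- x) = of_int (- n) + of_int (- m) * ((1 - sqrt 5) / 2)"
    by (rule ssubst) (rule K5_conj_O5)
  moreover have "K5_conj x = of_int n + of_int m * ((1 - sqrt 5) / 2)"
    unfolding x by (rule K5_conj_O5)
  ultimately show ?thesis by simp
qed

lemma SL2_O5_uminus: "A \<in> SL2_O5 \<Longrightarrow> - A \<in> SL2_O5"
  unfolding SL2_O5_def mem_Collect_eq det_2 uminus_vec_def vec_lambda_beta
  by (simp only: O5_uminus minus_mult_minus simp_thms)

lemma conj_mat_uminus: "A \<in> SL2_O5 \<Longrightarrow> conj_mat (- A) = - conj_mat A"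
  by (simp add: SL2_O5_def conj_mat_def vec_eq_iff K5_conj_uminus)

lemma PSL2_O5_eq: "PSL2_O5 = (\<lambda>A. {A, - A}) ` SL2_O5"
proof -
  have "sign_rel `` {A} = {A, - A}" if "A \<in> SL2_O5" for A
    using that SL2_O5_uminus[OF that] by (auto simp: sign_rel_def)
  then show ?thesis
    unfolding PSL2_O5_def quotient_def UNION_singleton_eq_range by (intro image_cong) simp_all
qed

lemma equiv_sign_rel: "equiv SL2_O5 sign_rel"
proof (rule equivI)
  show "sign_rel \<subseteq> SL2_O5 \<times> SL2_O5" unfolding sign_rel_def by blast
  show "refl_on SL2_O5 sign_rel" unfolding refl_on_def sign_rel_def by blast
  show "sym sign_rel" unfolding sym_def sign_rel_def by force
  show "trans sign_rel" unfolding trans_def sign_rel_def by auto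
qed

lemma Hilbert_modular_group_eq:
  "Hilbert_modular_group = (\<lambda>A. ({A, - A}, {conj_mat A, - conj_mat A})) ` SL2_O5"
proof -
  have "Hilbert_modular_group = (\<lambda>X. (X, conj_mat ` X)) ` PSL2_O5"
    unfolding Hilbert_modular_group_def by (rule Setcompr_eq_image)
  also have "\<dots> = (\<lambda>A. ({A, - A}, conj_mat ` {A, - A})) ` SL2_O5"
    unfolding PSL2_O5_eq image_image ..
  also have "\<dots> = (\<lambda>A. ({A, - A}, {conj_mat A, - conj_mat A})) ` SL2_O5"
    by (rule image_cong) (simp_all add: conj_mat_uminus)
  finally show ?thesis .
qed

lemma frac_lin_uminus: "frac_lin (- A) w = frac_lin A w"
proof -
  have "frac_lin (- A) w = (- (of_real (A $ 1 $ 1) * w + of_real (A $ 1 $ 2)))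
      / (- (of_real (A $ 2 $ 1) * w + of_real (A $ 2 $ 2)))"
    unfolding frac_lin_def by (simp add: algebra_simps)
  then show ?thesis unfolding frac_lin_def by (simp only: minus_divide_divide)
qed

lemma Hilbert_act_eq:
  assumes "\<gamma> \<in> Hilbert_modular_group" "A \<in> fst \<gamma>"
  shows "Hilbert_act \<gamma> z = (frac_lin A (fst z), frac_lin (conj_mat A) (snd z))"
proof -
  from assms(1) obtain B where B: "B \<in> SL2_O5" "\<gamma> = ({B, - B}, {conj_mat B, - conj_mat B})"
    unfolding Hilbert_modular_group_eq by (rule imageE)
  have fst: "frac_lin C w = frac_lin B w" if "C \<in> fst \<gamma>" for C w
    using that B(2) by (auto simp: frac_lin_uminus)
  have snd: "frac_lin C w = frac_lin (conj_mat B) w" if "C \<in> snd \<gamma>" for C w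
    using that B(2) by (auto simp: frac_lin_uminus)
  have some: "(SOME C. C \<in> fst \<gamma>) \<in> fst \<gamma>" "(SOME C. C \<in> snd \<gamma>) \<in> snd \<gamma>"
    unfolding B(2) by (rule someI[of _ B], simp) (rule someI[of _ "conj_mat B"], simp)
  have "A = B \<or> A = - B" using assms(2) B(2) by simp
  then have "conj_mat A \<in> snd \<gamma>"
    using conj_mat_uminus[OF B(1)] B(2) by auto
  then show ?thesis
    unfolding Hilbert_act_def
    using fst[OF some(1)] fst[OF assms(2)] snd[OF some(2)] snd by simp
qed


section \<open>Goetzky's domain\<close>

definition N5_orbit :: "complex \<times> complex \<Rightarrow> (complex \<times> complex) set" where
  "N5_orbit z = {(fst z + of_real \<nu>, snd z + of_real (K5_conj \<nu>)) | \<nu>. \<nu> \<in> O5}"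

definition U5 :: "(complex \<times> complex) set" where
  "U5 = {z \<in> H2. \<epsilon> powi (-2) \<le> Im (snd z) / Im (fst z) \<and> Im (snd z) / Im (fst z) < \<epsilon> ^ 2}"

definition T5 :: "(complex \<times> complex) set" where
  "T5 = {z \<in> H2. cmod (fst z * snd z) \<ge> 1}"

text \<open>\<open>S\<close> arises by choosing one minimizing point from each orbit; the choice is arbitrary.\<close>

definition is_S5 :: "(complex \<times> complex) set \<Rightarrow> bool" where
  "is_S5 S \<longleftrightarrow> S \<subseteq> H2 \<and>
     (\<forall>z \<in> H2. \<exists>w. S \<inter> N5_orbit z = {w} \<and>
        (\<forall>v \<in> N5_orbit z. cmod (fst w * snd w) \<le> cmod (fst v * snd v)))"

definition Goetzky_domain :: "(complex \<times> complex) set \<Rightarrow> (complex \<times> complex) set" where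
  "Goetzky_domain S = U5 \<inter> T5 \<inter> S"

definition special_elliptic_point :: "complex \<times> complex \<Rightarrow> bool" where
  "special_elliptic_point z \<longleftrightarrow>
     (\<exists>\<gamma> \<in> Hilbert_modular_group. totally_elliptic \<gamma> \<and> Hilbert_act \<gamma> z = z \<and>
        (\<exists>A \<in> fst \<gamma>. trace A = \<epsilon> \<or> trace A = inverse \<epsilon>))"

end

theory Submission
  imports Defs
begin

text \<open>Suppose that \<open>y\<^sub>1 y\<^sub>2 \<le> sqrt 5 / 4\<close>. We look for a translate of \<open>z\<close> with \<open>\<bar>z\<^sub>1 z\<^sub>2\<bar> < 1\<close>. Scaling by
  a unit makes \<open>y\<^sub>2 / y\<^sub>1\<close> lie between \<open>1 / \<epsilon>\<close> and \<open>\<epsilon>\<close>, and conjugation allows \<open>y\<^sub>2 \<le> y\<^sub>1\<close>. For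
  \<open>(x\<^sub>1, x\<^sub>2) = (a + b \<epsilon>, a + b \<epsilon>')\<close> one has
  \<open>\<bar>z\<^sub>1 z\<^sub>2\<bar>\<^sup>2 = (a\<^sup>2 + a b - b\<^sup>2)\<^sup>2 + A ((a + b)\<^sup>2 + b\<^sup>2) + B (a\<^sup>2 + b\<^sup>2) + (y\<^sub>1 y\<^sub>2)\<^sup>2\<close> with
  \<open>0 \<le> A \<le> B\<close> and \<open>A + B \<le> 5/4\<close>, so with \<open>s = A / (A + B)\<close> the claim becomes a statement about integer
  translates in the \<open>(a, b)\<close> plane, linear in \<open>s \<in> [0, 1/2]\<close>. Equality forces \<open>s = 0\<close> and
  \<open>a, b \<in> 1/2 + \<int>\<close>, and such a point is fixed by an explicit matrix whose lower left entry is the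
  scaling unit. Conversely, the fixed point of a matrix of trace \<open>\<epsilon>\<close> or \<open>1 / \<epsilon>\<close> and lower left entry
  \<open>c\<close> satisfies \<open>y\<^sub>1 y\<^sub>2 = sqrt 5 / (4 \<bar>N c\<bar>)\<close>, and for a unit \<open>c\<close> its orbit under translations
  depends only on \<open>c\<close> and the trace; Goetzky's domain leaves finitely many \<open>c\<close>.\<close>

section \<open>Integer translates in the plane\<close>

text \<open>With \<open>A = s * (X + Y)\<close> and \<open>B = (1 - s) * (X + Y)\<close>, the form
  \<open>A * ((a + b)^2 + b^2) + B * (a^2 + b^2)\<close> is \<open>X + Y\<close> times the quadratic
  form here, and 5/4 bounds \<open>X + Y\<close>. The quartic term is the squared norm of
  \<open>a + b * \<epsilon>\<close>. The threshold 11/16 used below is 1 - 5/16, where 5/16 is the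
  square of \<open>sqrt 5 / 4\<close>.\<close>

definition cell_fn :: "real \<Rightarrow> real \<Rightarrow> real \<Rightarrow> real" where
  "cell_fn s a b = (a^2 + a * b - b^2)^2 + 5/4 * (a^2 + 2 * s * a * b + (1 + s) * b^2)"

text \<open>In the following estimates \<open>x, y, z\<close> are the barycentric coordinates of \<open>(a, b)\<close> in a triangle, and
  the identity is the homogeneous expansion in them, which happens to have nonnegative coefficients.
  The triangles with a term \<open>y^4 + z^4\<close> have the critical point \<open>(1/2, 1/2)\<close> or \<open>(-1/2, 1/2)\<close> as the vertex
  \<open>x = 1\<close>; the extra term yields strictness elsewhere. Near \<open>(1/2, 1/2)\<close> no single translate works for all
  \<open>s\<close>, but the weights 1/4 and 3/4 balance the first order terms.\<close>

lemma cell_avg_horizontal_0: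
  fixes a b :: real
  defines "x \<equiv> (30 * a + 28 * b - 22) / 7" and "y \<equiv> (12 * a - 28 * b + 8) / 7" and "z \<equiv> - 6 * a + 3"
  assumes "0 \<le> x" "0 \<le> y" "0 \<le> z"
  shows "1 / 4 * cell_fn 0 a b + 3 / 4 * cell_fn 0 (a - 1) b + 1 / 250 * (y^4 + z^4) \<le> 11 / 16"
proof -
  have "11 / 16 - (1 / 4 * cell_fn 0 a b + 3 / 4 * cell_fn 0 (a - 1) b + 1 / 250 * (y^4 + z^4)) =
    158951 / 194481000 * z^4 + 56165 / 148176 * y * z^3 + 289 / 288 * y^2 * z^2
    + 2419 / 2688 * y^3 * z + 8497 / 32000 * y^4 + 5015 / 49392 * x * z^3
    + 1077 / 784 * x * y * z^2 + 185 / 84 * x * y^2 * z + 121 / 128 * x * y^3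
    + 631 / 3528 * x^2 * z^2 + 479 / 336 * x^2 * y * z + 71 / 64 * x^2 * y^2
    + 1 / 12 * x^3 * z + 7 / 16 * x^3 * y"
    unfolding cell_fn_def x_def y_def z_def by algebra
  also have "\<dots> \<ge> 0"
    using assms by (intro add_nonneg_nonneg mult_nonneg_nonneg zero_le_power) simp_all
  finally show ?thesis by simp
qed

lemma cell_avg_vertical_0:
  fixes a b :: real
  defines "x \<equiv> (30 * a + 56 * b - 34) / 9" and "y \<equiv> - 14 * b + 7" and "z \<equiv> (- 30 * a + 70 * b - 20) / 9"
  assumes "0 \<le> x" "0 \<le> y" "0 \<le> z"
  shows "1 / 4 * cell_fn 0 a b + 3 / 4 * cell_fn 0 a (b - 1) + 1 / 250 * (y^4 + z^4) \<le> 11 / 16"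
proof -
  have "11 / 16 - (1 / 4 * cell_fn 0 a b + 3 / 4 * cell_fn 0 a (b - 1) + 1 / 250 * (y^4 + z^4)) =
    2459 / 10000 * z^4 + 35783 / 42000 * y * z^3 + 12781 / 12600 * y^2 * z^2
    + 16673 / 35280 * y^3 * z + 10947701 / 194481000 * y^4 + 1701 / 2000 * x * z^3
    + 563 / 280 * x * y * z^2 + 24499 / 17640 * x * y^2 * z + 3761 / 16464 * x * y^3
    + 387 / 400 * x^2 * z^2 + 363 / 280 * x^2 * y * z + 1009 / 3528 * x^2 * y^2
    + 3 / 8 * x^3 * z + 5 / 42 * x^3 * y"
    unfolding cell_fn_def x_def y_def z_def by algebra
  also have "\<dots> \<ge> 0"
    using assms by (intro add_nonneg_nonneg mult_nonneg_nonneg zero_le_power) simp_all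
  finally show ?thesis by simp
qed

lemma cell_opposite_below_0:
  fixes a b :: real
  defines "x \<equiv> 2 * b" and "y \<equiv> 2 * a + 1" and "z \<equiv> - 2 * a - 2 * b"
  assumes "0 \<le> x" "0 \<le> y" "0 \<le> z"
  shows "cell_fn 0 a b + 1 / 250 * (y^4 + z^4) \<le> 11 / 16"
proof -
  have "11 / 16 - (cell_fn 0 a b + 1 / 250 * (y^4 + z^4)) =
    617 / 2000 * z^4 + 17 / 8 * y * z^3 + 61 / 16 * y^2 * z^2
    + 11 / 4 * y^3 * z + 1367 / 2000 * y^4 + 11 / 8 * x * z^3
    + 51 / 8 * x * y * z^2 + 61 / 8 * x * y^2 * z + 11 / 4 * x * y^3
    + 2 * x^2 * z^2 + 23 / 4 * x^2 * y * z + 7 / 2 * x^2 * y^2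
    + 1 * x^3 * z + 3 / 2 * x^3 * y"
    unfolding cell_fn_def x_def y_def z_def by algebra
  also have "\<dots> \<ge> 0"
    using assms by (intro add_nonneg_nonneg mult_nonneg_nonneg zero_le_power) simp_all
  finally show ?thesis by simp
qed

lemma cell_opposite_above_0:
  fixes a b :: real
  defines "x \<equiv> - 2 * a" and "y \<equiv> - 2 * b + 1" and "z \<equiv> 2 * a + 2 * b"
  assumes "0 \<le> x" "0 \<le> y" "0 \<le> z"
  shows "cell_fn 0 a b + 1 / 250 * (y^4 + z^4) \<le> 11 / 16"
proof -
  have "11 / 16 - (cell_fn 0 a b + 1 / 250 * (y^4 + z^4)) =
    617 / 2000 * z^4 + 17 / 8 * y * z^3 + 61 / 16 * y^2 * z^2
    + 11 / 4 * y^3 * z + 1367 / 2000 * y^4 + 9 / 8 * x * z^3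
    + 51 / 8 * x * y * z^2 + 61 / 8 * x * y^2 * z + 11 / 4 * x * y^3
    + 5 / 4 * x^2 * z^2 + 23 / 4 * x^2 * y * z + 7 / 2 * x^2 * y^2
    + 1 / 2 * x^3 * z + 3 / 2 * x^3 * y"
    unfolding cell_fn_def x_def y_def z_def by algebra
  also have "\<dots> \<ge> 0"
    using assms by (intro add_nonneg_nonneg mult_nonneg_nonneg zero_le_power) simp_all
  finally show ?thesis by simp
qed

lemma cell_avg_horizontal_half:
  fixes a b :: real
  defines "x \<equiv> (30 * a + 28 * b - 22) / 7" and "y \<equiv> (12 * a - 28 * b + 8) / 7" and "z \<equiv> - 6 * a + 3"
  assumes "0 \<le> x" "0 \<le> y" "0 \<le> z"
  shows "1 / 4 * cell_fn (1/2) a b + 3 / 4 * cell_fn (1/2) (a - 1) b + 1 / 250 * (y^4 + z^4) \<le> 11 / 16"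
proof -
  have "11 / 16 - (1 / 4 * cell_fn (1/2) a b + 3 / 4 * cell_fn (1/2) (a - 1) b + 1 / 250 * (y^4 + z^4)) =
    42488527 / 388962000 * z^4 + 430355 / 592704 * y * z^3 + 79669 / 56448 * y^2 * z^2
    + 993 / 896 * y^3 * z + 9747 / 32000 * y^4 + 43945 / 98784 * x * z^3
    + 6843 / 3136 * x * y * z^2 + 1265 / 448 * x * y^2 * z + 141 / 128 * x * y^3
    + 953 / 1764 * x^2 * z^2 + 2641 / 1344 * x^2 * y * z + 167 / 128 * x^2 * y^2
    + 47 / 224 * x^3 * z + 33 / 64 * x^3 * y"
    unfolding cell_fn_def x_def y_def z_def by algebra
  also have "\<dots> \<ge> 0"
    using assms by (intro add_nonneg_nonneg mult_nonneg_nonneg zero_le_power) simp_all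
  finally show ?thesis by simp
qed

lemma cell_avg_vertical_half:
  fixes a b :: real
  defines "x \<equiv> (30 * a + 56 * b - 34) / 9" and "y \<equiv> - 14 * b + 7" and "z \<equiv> (- 30 * a + 70 * b - 20) / 9"
  assumes "0 \<le> x" "0 \<le> y" "0 \<le> z"
  shows "1 / 4 * cell_fn (1/2) a b + 3 / 4 * cell_fn (1/2) a (b - 1) + 1 / 250 * (y^4 + z^4) \<le> 11 / 16"
proof -
  have "11 / 16 - (1 / 4 * cell_fn (1/2) a b + 3 / 4 * cell_fn (1/2) a (b - 1) + 1 / 250 * (y^4 + z^4)) =
    3043 / 20000 * z^4 + 14397 / 28000 * y * z^3 + 50467 / 88200 * y^2 * z^2
    + 15991 / 70560 * y^3 * z + 6581429 / 777924000 * y^4 + 2277 / 4000 * x * z^3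
    + 731 / 560 * x * y * z^2 + 59221 / 70560 * x * y^2 * z + 106 / 1029 * x * y^3
    + 549 / 800 * x^2 * z^2 + 1007 / 1120 * x^2 * y * z + 2521 / 14112 * x^2 * y^2
    + 9 / 32 * x^3 * z + 5 / 56 * x^3 * y"
    unfolding cell_fn_def x_def y_def z_def by algebra
  also have "\<dots> \<ge> 0"
    using assms by (intro add_nonneg_nonneg mult_nonneg_nonneg zero_le_power) simp_all
  finally show ?thesis by simp
qed

lemma cell_opposite_below_half:
  fixes a b :: real
  defines "x \<equiv> 2 * b" and "y \<equiv> 2 * a + 1" and "z \<equiv> - 2 * a - 2 * b"
  assumes "0 \<le> x" "0 \<le> y" "0 \<le> z"
  shows "cell_fn (1/2) a b \<le> 137 / 200"
proof -
  have "137 / 200 - (cell_fn (1/2) a b) =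
    31 / 100 * z^4 + 423 / 200 * y * z^3 + 1519 / 400 * y^2 * z^2
    + 137 / 50 * y^3 * z + 137 / 200 * y^4 + 671 / 400 * x * z^3
    + 697 / 100 * x * y * z^2 + 3163 / 400 * x * y^2 * z + 137 / 50 * x * y^3
    + 2213 / 800 * x^2 * z^2 + 2663 / 400 * x^2 * y * z + 2913 / 800 * x^2 * y^2
    + 323 / 200 * x^3 * z + 721 / 400 * x^3 * y + 123 / 800 * x^4"
    unfolding cell_fn_def x_def y_def z_def by algebra
  also have "\<dots> \<ge> 0"
    using assms by (intro add_nonneg_nonneg mult_nonneg_nonneg zero_le_power) simp_all
  finally show ?thesis by simp
qed

lemma cell_opposite_above_half:
  fixes a b :: real
  defines "x \<equiv> - 2 * a" and "y \<equiv> - 2 * b + 1" and "z \<equiv> 2 * a + 2 * b"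
  assumes "0 \<le> x" "0 \<le> y" "0 \<le> z"
  shows "cell_fn (1/2) a b \<le> 137 / 200"
proof -
  have "137 / 200 - (cell_fn (1/2) a b) =
    123 / 800 * z^4 + 721 / 400 * y * z^3 + 2913 / 800 * y^2 * z^2
    + 137 / 50 * y^3 * z + 137 / 200 * y^4 + 321 / 400 * x * z^3
    + 2413 / 400 * x * y * z^2 + 1519 / 200 * x * y^2 * z + 137 / 50 * x * y^3
    + 247 / 200 * x^2 * z^2 + 2413 / 400 * x^2 * y * z + 2913 / 800 * x^2 * y^2
    + 321 / 400 * x^3 * z + 721 / 400 * x^3 * y + 123 / 800 * x^4"
    unfolding cell_fn_def x_def y_def z_def by algebra
  also have "\<dots> \<ge> 0"
    using assms by (intro add_nonneg_nonneg mult_nonneg_nonneg zero_le_power) simp_all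
  finally show ?thesis by simp
qed

lemma cell_cone_1:
  fixes a b :: real
  defines "x \<equiv> - 2 * a + 1" and "y \<equiv> 2 * a - 4 * b" and "z \<equiv> 4 * b"
  assumes "0 \<le> x" "0 \<le> y" "0 \<le> z"
  shows "cell_fn (1/2) a b \<le> 137 / 200"
proof -
  have "137 / 200 - (cell_fn (1/2) a b) =
    9 / 6400 * z^4 + 317 / 800 * y * z^3 + 3527 / 3200 * y^2 * z^2
    + 817 / 800 * y^3 * z + 31 / 100 * y^4 + 2509 / 1600 * x * z^3
    + 8777 / 1600 * x * y * z^2 + 2413 / 400 * x * y^2 * z + 423 / 200 * x * y^3
    + 11277 / 3200 * x^2 * z^2 + 5951 / 800 * x^2 * y * z + 1519 / 400 * x^2 * y^2
    + 137 / 50 * x^3 * z + 137 / 50 * x^3 * y + 137 / 200 * x^4"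
    unfolding cell_fn_def x_def y_def z_def by algebra
  also have "\<dots> \<ge> 0"
    using assms by (intro add_nonneg_nonneg mult_nonneg_nonneg zero_le_power) simp_all
  finally show ?thesis by simp
qed

lemma cell_cone_2:
  fixes a b :: real
  defines "x \<equiv> (- 15 * a - 14 * b + 11) / 11" and "y \<equiv> (36 * a - 28 * b) / 11" and "z \<equiv> (- 21 * a + 42 * b) / 11"
  assumes "0 \<le> x" "0 \<le> y" "0 \<le> z"
  shows "cell_fn (1/2) a b \<le> 137 / 200"
proof -
  have "137 / 200 - (cell_fn (1/2) a b) =
    354161 / 19448100 * z^4 + 3161 / 18900 * y * z^3 + 372157 / 1411200 * y^2 * z^2
    + 1313 / 11200 * y^3 * z + 9 / 6400 * y^4 + 62459 / 44100 * x * z^3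
    + 199127 / 44100 * x * y * z^2 + 156817 / 33600 * x * y^2 * z + 2509 / 1600 * x * y^3
    + 304127 / 88200 * x^2 * z^2 + 7381 / 1050 * x^2 * y * z + 11277 / 3200 * x^2 * y^2
    + 137 / 50 * x^3 * z + 137 / 50 * x^3 * y + 137 / 200 * x^4"
    unfolding cell_fn_def x_def y_def z_def by algebra
  also have "\<dots> \<ge> 0"
    using assms by (intro add_nonneg_nonneg mult_nonneg_nonneg zero_le_power) simp_all
  finally show ?thesis by simp
qed

lemma cell_cone_3:
  fixes a b :: real
  defines "x \<equiv> (- 15 * a - 28 * b + 17) / 17" and "y \<equiv> (105 * a - 42 * b) / 17" and "z \<equiv> (- 90 * a + 70 * b) / 17"
  assumes "0 \<le> x" "0 \<le> y" "0 \<le> z"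
  shows "cell_fn (1/2) a b \<le> 137 / 200"
proof -
  have "137 / 200 - (cell_fn (1/2) a b) =
    583 / 20000 * z^4 + 2203 / 14000 * y * z^3 + 87001 / 352800 * y^2 * z^2
    + 42173 / 308700 * y^3 * z + 354161 / 19448100 * y^4 + 581 / 400 * x * z^3
    + 12211 / 2800 * x * y * z^2 + 190727 / 44100 * x * y^2 * z + 62459 / 44100 * x * y^3
    + 2773 / 800 * x^2 * z^2 + 2427 / 350 * x^2 * y * z + 304127 / 88200 * x^2 * y^2
    + 137 / 50 * x^3 * z + 137 / 50 * x^3 * y + 137 / 200 * x^4"
    unfolding cell_fn_def x_def y_def z_def by algebra
  also have "\<dots> \<ge> 0"
    using assms by (intro add_nonneg_nonneg mult_nonneg_nonneg zero_le_power) simp_all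
  finally show ?thesis by simp
qed

lemma cell_cone_4:
  fixes a b :: real
  defines "x \<equiv> - 2 * b + 1" and "y \<equiv> 5 * a" and "z \<equiv> - 5 * a + 2 * b"
  assumes "0 \<le> x" "0 \<le> y" "0 \<le> z"
  shows "cell_fn (1/2) a b \<le> 137 / 200"
proof -
  have "137 / 200 - (cell_fn (1/2) a b) =
    123 / 800 * z^4 + 27 / 50 * y * z^3 + 263 / 400 * y^2 * z^2
    + 151 / 500 * y^3 * z + 583 / 20000 * y^4 + 721 / 400 * x * z^3
    + 2063 / 400 * x * y * z^2 + 1923 / 400 * x * y^2 * z + 581 / 400 * x * y^3
    + 2913 / 800 * x^2 * z^2 + 2863 / 400 * x^2 * y * z + 2773 / 800 * x^2 * y^2
    + 137 / 50 * x^3 * z + 137 / 50 * x^3 * y + 137 / 200 * x^4"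
    unfolding cell_fn_def x_def y_def z_def by algebra
  also have "\<dots> \<ge> 0"
    using assms by (intro add_nonneg_nonneg mult_nonneg_nonneg zero_le_power) simp_all
  finally show ?thesis by simp
qed

section \<open>Covering the plane by the triangles, uniformly in s\<close>

lemma cell_fn_minus: "cell_fn s (- a) (- b) = cell_fn s a b"
  unfolding cell_fn_def by algebra

lemma cell_fn_affine: "cell_fn s a b = (1 - 2 * s) * cell_fn 0 a b + 2 * s * cell_fn (1/2) a b"
  unfolding cell_fn_def by algebra

text \<open>The four triangles form a fan with apex (0, 0) over the points (1/2, 0), (1/2, 1/4),
  (1/3, 3/7), (1/5, 1/2), (0, 1/2). The value at (1/2, 1/4) is 175/256, just below 137/200, which in
  turn is below 11/16.\<close>

lemma cell_cone:
  fixes a b :: real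
  assumes "0 \<le> a" "a \<le> 1/2" "0 \<le> b" "b \<le> 1/2"
    and "15 * a + 14 * b \<le> 11" "15 * a + 28 * b \<le> 17"
  shows "cell_fn (1/2) a b \<le> 137 / 200"
proof -
  consider "2 * b \<le> a" | "a \<le> 2 * b" "7 * b \<le> 9 * a" | "9 * a \<le> 7 * b" "2 * b \<le> 5 * a" | "5 * a \<le> 2 * b"
    by linarith
  then show ?thesis
  proof cases
    case 1 then show ?thesis using assms by (intro cell_cone_1) auto
  next
    case 2 then show ?thesis using assms by (intro cell_cone_2) auto
  next
    case 3 then show ?thesis using assms by (intro cell_cone_3) auto
  next
    case 4 then show ?thesis using assms by (intro cell_cone_4) auto
  qed
qed

lemma quartic_slack:
  fixes u c y z :: real
  assumes "u + 1 / 250 * (y^4 + z^4) \<le> c"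
  shows "u \<le> c" and "y \<noteq> 0 \<or> z \<noteq> 0 \<Longrightarrow> u < c"
proof -
  have "0 \<le> 1 / 250 * (y^4 + z^4)" by simp
  then show "u \<le> c" using assms by linarith
  show "u < c" if "y \<noteq> 0 \<or> z \<noteq> 0"
  proof -
    have "0 < 1 / 250 * (y^4 + z^4)"
      using that by (auto simp: add_pos_nonneg add_nonneg_pos zero_less_power_eq)
    then show ?thesis using assms by linarith
  qed
qed

text \<open>For s = 0 the value 11/16 is attained at (-1/2, 1/2) only, and for s = 1/2 the bound
  137/200 leaves a margin. Interpolation in s leaves that corner with s = 0 as the only
  exception.\<close>

lemma cell_opposite_quadrant:
  fixes a b s :: real
  assumes "- (1/2) \<le> a" "a \<le> 0" "0 \<le> b" "b \<le> 1/2" "0 \<le> s" "s \<le> 1/2"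
    and "s \<noteq> 0 \<or> a \<noteq> - (1/2) \<or> b \<noteq> 1/2"
  shows "cell_fn s a b < 11 / 16"
proof -
  have h: "cell_fn (1/2) a b \<le> 137 / 200"
    using assms cell_opposite_below_half[of b a] cell_opposite_above_half[of a b] by linarith
  have z: "cell_fn 0 a b \<le> 11 / 16" (is ?le)
    and z': "a \<noteq> - (1/2) \<or> b \<noteq> 1/2 \<Longrightarrow> cell_fn 0 a b < 11 / 16" (is "?ne \<Longrightarrow> ?lt")
  proof -
    consider "a + b \<le> 0" | "a + b \<ge> 0" by linarith
    then have "?le \<and> (?ne \<longrightarrow> ?lt)"
    proof cases
      case 1
      have *: "cell_fn 0 a b + 1 / 250 * ((2 * a + 1)^4 + (- 2 * a - 2 * b)^4) \<le> 11 / 16"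
        using assms 1 by (intro cell_opposite_below_0) auto
      have "2 * a + 1 \<noteq> 0 \<or> - 2 * a - 2 * b \<noteq> 0" if ?ne using that by argo
      then show ?thesis using quartic_slack[OF *] by blast
    next
      case 2
      have *: "cell_fn 0 a b + 1 / 250 * ((- 2 * b + 1)^4 + (2 * a + 2 * b)^4) \<le> 11 / 16"
        using assms 2 by (intro cell_opposite_above_0) auto
      have "- 2 * b + 1 \<noteq> 0 \<or> 2 * a + 2 * b \<noteq> 0" if ?ne using that by argo
      then show ?thesis using quartic_slack[OF *] by blast
    qed
    then show ?le "?ne \<Longrightarrow> ?lt" by blast+
  qed
  show ?thesis
  proof (cases "s = 0")
    case True
    then show ?thesis using assms z' by simp
  next
    case False
    have "(1 - 2 * s) * cell_fn 0 a b \<le> (1 - 2 * s) * (11 / 16)"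
      using assms z by (intro mult_left_mono) auto
    moreover have "2 * s * cell_fn (1/2) a b < 2 * s * (11 / 16)"
      using assms h False by (intro mult_strict_left_mono) auto
    ultimately show ?thesis unfolding cell_fn_affine[of s] by argo
  qed
qed

text \<open>The weighted average is affine in s, so it stays below c between the endpoints, and the
  smaller value is at most the average. Which of the two is smaller may depend on s.\<close>

lemma cell_fn_average_affine:
  assumes "1 / 4 * cell_fn 0 a b + 3 / 4 * cell_fn 0 a' b' < c"
    "1 / 4 * cell_fn (1/2) a b + 3 / 4 * cell_fn (1/2) a' b' < c" "0 \<le> s" "s \<le> 1/2"
  shows "cell_fn s a b < c \<or> cell_fn s a' b' < c"
proof -
  define u v where "u = 1 / 4 * cell_fn 0 a b + 3 / 4 * cell_fn 0 a' b'"
    and "v = 1 / 4 * cell_fn (1/2) a b + 3 / 4 * cell_fn (1/2) a' b'"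
  have "1 / 4 * cell_fn s a b + 3 / 4 * cell_fn s a' b' = (1 - 2 * s) * u + 2 * s * v"
    unfolding u_def v_def cell_fn_affine[of s a] cell_fn_affine[of s a'] by algebra
  also have "\<dots> < c"
    using assms(1,2)[folded u_def v_def] assms(3,4) by (intro convex_bound_lt) auto
  finally show ?thesis by linarith
qed

text \<open>What the fan leaves near (1/2, 1/2) consists of two triangles with the common side from
  (1/2, 1/2) to (1/3, 3/7), on the line \<open>7 * b = 3 * a + 2\<close>. Their third vertices are
  (1/2, 1/4), where a horizontal translate is averaged in, and (1/5, 1/2), where a vertical one
  is.\<close>

lemma cell_corner:
  fixes a b s :: real
  assumes "a \<le> 1/2" "b \<le> 1/2" "0 \<le> s" "s \<le> 1/2" "a \<noteq> 1/2 \<or> b \<noteq> 1/2"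
    and "15 * a + 14 * b \<ge> 11 \<or> 15 * a + 28 * b \<ge> 17"
  shows "cell_fn s a b < 11/16 \<or> cell_fn s (a - 1) b < 11/16 \<or> cell_fn s a (b - 1) < 11/16"
proof (cases "7 * b \<le> 3 * a + 2")
  case True
  \<comment> \<open>Both barycentric coordinates vanish only at the excluded point (1/2,
    1/2).\<close>
  have ne: "(12 * a - 28 * b + 8) / 7 \<noteq> 0 \<or> - 6 * a + 3 \<noteq> 0" using assms by argo
  have "0 \<le> (30 * a + 28 * b - 22) / 7" "0 \<le> (12 * a - 28 * b + 8) / 7" "0 \<le> - 6 * a + 3"
    using assms True by auto
  then have "cell_fn s a b < 11/16 \<or> cell_fn s (a - 1) b < 11/16"
    using assms quartic_slack(2)[OF cell_avg_horizontal_0 ne] quartic_slack(2)[OF cell_avg_horizontal_half ne]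
    by (intro cell_fn_average_affine) blast+
  then show ?thesis by blast
next
  case False
  have ne: "- 14 * b + 7 \<noteq> 0 \<or> (- 30 * a + 70 * b - 20) / 9 \<noteq> 0" using assms by argo
  have "0 \<le> (30 * a + 56 * b - 34) / 9" "0 \<le> - 14 * b + 7" "0 \<le> (- 30 * a + 70 * b - 20) / 9"
    using assms False by auto
  then have "cell_fn s a b < 11/16 \<or> cell_fn s a (b - 1) < 11/16"
    using assms quartic_slack(2)[OF cell_avg_vertical_0 ne] quartic_slack(2)[OF cell_avg_vertical_half ne]
    by (intro cell_fn_average_affine) blast+
  then show ?thesis by blast
qed

lemma cell_half_square:
  fixes a b s :: real
  assumes "\<bar>a\<bar> \<le> 1/2" "0 \<le> b" "b \<le> 1/2" "0 \<le> s" "s \<le> 1/2"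
    and "s \<noteq> 0 \<or> \<bar>a\<bar> \<noteq> 1/2 \<or> b \<noteq> 1/2"
  shows "\<exists>m n :: int. cell_fn s (a - of_int m) (b - of_int n) < 11/16"
proof -
  have "cell_fn s (a - of_int 0) (b - of_int 0) < 11/16 \<or> cell_fn s (a - of_int 1) (b - of_int 0) < 11/16
    \<or> cell_fn s (a - of_int 0) (b - of_int 1) < 11/16"
  proof (cases "a \<le> 0")
    case True
    then have "cell_fn s a b < 11 / 16"
      using assms by (intro cell_opposite_quadrant) auto
    then show ?thesis by simp
  next
    case a: False
    consider "a = 1/2" "b = 1/2" | "15 * a + 14 * b \<le> 11" "15 * a + 28 * b \<le> 17"
      | "a \<noteq> 1/2 \<or> b \<noteq> 1/2" "15 * a + 14 * b \<ge> 11 \<or> 15 * a + 28 * b \<ge> 17"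
      by linarith
    then show ?thesis
    proof cases
      case 1
      \<comment> \<open>The corner moves to (-1/2, 1/2), where the bound is strict because s is
        nonzero here.\<close>
      then have "cell_fn s (a - 1) b < 11 / 16"
        using assms by (intro cell_opposite_quadrant) auto
      then show ?thesis by simp
    next
      case 2
      \<comment> \<open>For nonnegative a and b the value increases with s, so s = 1/2 is the worst
        case.\<close>
      have "cell_fn s a b \<le> cell_fn (1/2) a b"
        using assms a unfolding cell_fn_def
        by (intro add_left_mono mult_left_mono add_mono mult_right_mono) auto
      also have "\<dots> < 11 / 16"
        using cell_cone[of a b] 2 assms a by auto
      finally show ?thesis by simp
    next
      case 3
      then show ?thesis using cell_corner[of a b s] assms by auto
    qed
  qed
  then show ?thesis by blast
qed

text \<open>Rounding brings both coordinates into [-1/2, 1/2], and the symmetry under negation of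
  (a, b) gives b \<ge> 0. In the excluded case all four nearest translates give exactly
  11/16.\<close>

lemma cell_covering:
  fixes a b s :: real
  assumes s: "0 \<le> s" "s \<le> 1/2"
    and hole: "s \<noteq> 0 \<or> a - 1/2 \<notin> \<int> \<or> b - 1/2 \<notin> \<int>"
  shows "\<exists>m n :: int. cell_fn s (a - of_int m) (b - of_int n) < 11/16"
proof -
  define a1 b1 where "a1 = a - of_int (round a)" and "b1 = b - of_int (round b)"
  have a1: "\<bar>a1\<bar> \<le> 1/2" and b1: "\<bar>b1\<bar> \<le> 1/2"
    unfolding a1_def b1_def using of_int_round_abs_le[of a] of_int_round_abs_le[of b]
    by (simp_all add: abs_minus_commute)
  have shift: "x - 1/2 \<in> \<int>" if "\<bar>x - of_int k\<bar> = 1/2" for x :: real and k :: int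
  proof -
    have "x - 1/2 = of_int k \<or> x - 1/2 = of_int (k - 1)" using that by (auto simp: abs_if split: if_splits)
    then show ?thesis by (metis Ints_of_int)
  qed
  have hole1: "s \<noteq> 0 \<or> \<bar>a1\<bar> \<noteq> 1/2 \<or> \<bar>b1\<bar> \<noteq> 1/2"
    using hole shift unfolding a1_def b1_def by blast
  show ?thesis
  proof (cases "b1 \<ge> 0")
    case True
    then obtain m n :: int where "cell_fn s (a1 - of_int m) (b1 - of_int n) < 11/16"
      using cell_half_square[of a1 b1 s] a1 b1 hole1 s by auto
    then have "cell_fn s (a - of_int (round a + m)) (b - of_int (round b + n)) < 11/16"
      by (simp add: a1_def b1_def algebra_simps)
    then show ?thesis by blast
  next
    case False
    then obtain m n :: int where "cell_fn s (- a1 - of_int m) (- b1 - of_int n) < 11/16"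
      using cell_half_square[of "- a1" "- b1" s] a1 b1 hole1 s by auto
    then have "cell_fn s (- (- a1 - of_int m)) (- (- b1 - of_int n)) < 11/16"
      by (simp only: cell_fn_minus)
    then have "cell_fn s (a - of_int (round a - m)) (b - of_int (round b - n)) < 11/16"
      by (simp add: a1_def b1_def algebra_simps)
    then show ?thesis by blast
  qed
qed

section \<open>The ring of integers\<close>

lemma eps_square: "\<epsilon>\<^sup>2 = \<epsilon> + 1"
  by (simp add: \<epsilon>_def power2_eq_square field_simps)

lemma eps_gt_1: "1 < \<epsilon>"
  by (simp add: \<epsilon>_def)

lemma eps_less_2: "\<epsilon> < 2"
  by (simp add: \<epsilon>_def real_less_lsqrt)

lemma K5_conj_O5_eps: "K5_conj (of_int n + of_int m * \<epsilon>) = of_int n + of_int m * (1 - \<epsilon>)"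
  unfolding K5_conj_O5 by (simp add: \<epsilon>_def field_simps)

lemma inverse_eps: "inverse \<epsilon> = \<epsilon> - 1"
  using eps_square eps_gt_1 by (simp add: field_simps power2_eq_square)

section \<open>From the plane to products over both conjugates\<close>

text \<open>\<open>X\<close> and \<open>Y\<close> stand for the squared heights after scaling by a
  unit, \<open>a\<close> and \<open>b\<close> for the coordinates of the scaled real parts in the
  basis 1, \<epsilon>. The two bounds on the ratio amount to \<open>0 \<le> A\<close> and
  \<open>A \<le> B\<close>, hence to s in [0, 1/2].\<close>

lemma lattice_point_below_1:
  fixes a b X Y :: real
  assumes "0 < Y" "Y \<le> X" "X \<le> \<epsilon>\<^sup>2 * Y" "X * Y \<le> 5 / 16"
    and hole: "X * Y \<noteq> 5 / 16 \<or> X \<noteq> \<epsilon>\<^sup>2 * Y \<or> a - 1/2 \<notin> \<int> \<or> b - 1/2 \<notin> \<int>"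
  shows "\<exists>m n :: int. ((a - of_int m + (b - of_int n) * \<epsilon>)\<^sup>2 + X)
    * ((a - of_int m + (b - of_int n) * (1 - \<epsilon>))\<^sup>2 + Y) < 1"
proof -
  \<comment> \<open>Found by comparing coefficients in the identity \<open>T\<close> below: the term
    in \<open>u * v\<close> gives \<open>A\<close>, the term in \<open>u^2\<close> gives
    \<open>A + B = X + Y\<close>.\<close>
  define A B where "A = \<epsilon> * Y - (\<epsilon> - 1) * X" and "B = \<epsilon> * X - (\<epsilon> - 1) * Y"
  define s where "s = A / (X + Y)"
  have XY: "0 < X + Y" using assms by linarith
  have "(\<epsilon> - 1) * X \<le> (\<epsilon> - 1) * (\<epsilon>\<^sup>2 * Y)"
    using assms eps_gt_1 by (intro mult_left_mono) auto
  also have "\<dots> = \<epsilon> * Y" using eps_square by algebra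
  finally have A: "0 \<le> A" by (simp add: A_def)
  have "B - A = (2 * \<epsilon> - 1) * (X - Y)" unfolding A_def B_def by algebra
  moreover have "0 \<le> (2 * \<epsilon> - 1) * (X - Y)" using assms eps_gt_1 by simp
  ultimately have AB: "A \<le> B" by linarith
  have sum: "A + B = X + Y" unfolding A_def B_def by algebra
  have s: "0 \<le> s" "s \<le> 1/2"
    unfolding s_def using A AB sum XY by (auto simp: field_simps)
  have sA: "A = s * (X + Y)" unfolding s_def using XY by simp
  have "(X + Y)\<^sup>2 \<le> (5 / 4)\<^sup>2"
  proof -
    \<comment> \<open>As \<open>A\<close> and \<open>B\<close> are nonnegative, this turns the bound
      on \<open>X * Y\<close> into one on \<open>X + Y\<close>.\<close>
    have "5 * (X * Y) - (X + Y)\<^sup>2 = A * B" unfolding A_def B_def using eps_square by algebra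
    moreover have "0 \<le> A * B" using A AB by simp
    ultimately have "(X + Y)\<^sup>2 \<le> 5 * (X * Y)" by linarith
    then show ?thesis using assms(4) by (simp add: power2_eq_square)
  qed
  then have XY_le: "X + Y \<le> 5 / 4" by (rule power2_le_imp_le) simp
  have bound: "((u + v * \<epsilon>)\<^sup>2 + X) * ((u + v * (1 - \<epsilon>))\<^sup>2 + Y) \<le> cell_fn s u v + X * Y"
    for u v :: real
  proof -
    define Q where "Q = u\<^sup>2 + 2 * s * u * v + (1 + s) * v\<^sup>2"
    have "Q = (u + s * v)\<^sup>2 + (1 + s * (1 - s)) * v\<^sup>2" unfolding Q_def by algebra
    also have "\<dots> \<ge> 0" using s by simp
    finally have Q: "0 \<le> Q" .
    have expand: "(p\<^sup>2 + X) * (q\<^sup>2 + Y) = (p * q)\<^sup>2 + (p\<^sup>2 * Y + X * q\<^sup>2) + X * Y" for p q :: real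
      by algebra
    have N: "(u + v * \<epsilon>) * (u + v * (1 - \<epsilon>)) = u\<^sup>2 + u * v - v\<^sup>2"
      using eps_square by algebra
    have sq: "(u + v * \<epsilon>)\<^sup>2 = u\<^sup>2 + 2 * u * v * \<epsilon> + v\<^sup>2 * (\<epsilon> + 1)"
      "(u + v * (1 - \<epsilon>))\<^sup>2 = u\<^sup>2 + 2 * u * v * (1 - \<epsilon>) + v\<^sup>2 * (2 - \<epsilon>)"
      using eps_square by algebra+
    have T: "(u + v * \<epsilon>)\<^sup>2 * Y + X * (u + v * (1 - \<epsilon>))\<^sup>2 = A * ((u + v)\<^sup>2 + v\<^sup>2) + B * (u\<^sup>2 + v\<^sup>2)"
      unfolding A_def B_def sq by algebra
    have "((u + v * \<epsilon>)\<^sup>2 + X) * ((u + v * (1 - \<epsilon>))\<^sup>2 + Y)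
        = ((u + v * \<epsilon>) * (u + v * (1 - \<epsilon>)))\<^sup>2 + ((u + v * \<epsilon>)\<^sup>2 * Y + X * (u + v * (1 - \<epsilon>))\<^sup>2) + X * Y"
      by (rule expand)
    also have "\<dots> = (u\<^sup>2 + u * v - v\<^sup>2)\<^sup>2 + (A * ((u + v)\<^sup>2 + v\<^sup>2) + B * (u\<^sup>2 + v\<^sup>2)) + X * Y"
      unfolding N T ..
    also have "A * ((u + v)\<^sup>2 + v\<^sup>2) + B * (u\<^sup>2 + v\<^sup>2) = (X + Y) * Q"
    proof -
      have "B = (1 - s) * (X + Y)" using sum sA by algebra
      then show ?thesis unfolding Q_def sA by algebra
    qed
    also have "(X + Y) * Q \<le> 5 / 4 * Q" using XY_le Q by (rule mult_right_mono)
    finally show ?thesis unfolding cell_fn_def Q_def by simp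
  qed
  show ?thesis
  proof (cases "s \<noteq> 0 \<or> a - 1/2 \<notin> \<int> \<or> b - 1/2 \<notin> \<int>")
    case True
    then obtain m n :: int where "cell_fn s (a - of_int m) (b - of_int n) < 11/16"
      using cell_covering s by blast
    then have "((a - of_int m + (b - of_int n) * \<epsilon>)\<^sup>2 + X)
      * ((a - of_int m + (b - of_int n) * (1 - \<epsilon>))\<^sup>2 + Y) < 1"
      using bound[of "a - of_int m" "b - of_int n"] assms(4) by linarith
    then show ?thesis by blast
  next
    case False
    then have "A = 0" using sA by simp
    then have "X = \<epsilon>\<^sup>2 * Y" unfolding A_def using eps_square by algebra
    \<comment> \<open>In the hole \<open>cell_fn\<close> is exactly 11/16, so the strict inequality
      has to come from the product of the squared heights.\<close>
    then have XY_less: "X * Y < 5 / 16" using hole False assms(4) by auto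
    obtain m n :: int where "a - 1/2 = of_int m" "b - 1/2 = of_int n"
      using False unfolding Ints_def by blast
    then have half: "a - of_int m = 1/2" "b - of_int n = 1/2" by linarith+
    have "cell_fn s (a - of_int m) (b - of_int n) = 11 / 16"
      unfolding half using False by (simp add: cell_fn_def power2_eq_square)
    then have "((a - of_int m + (b - of_int n) * \<epsilon>)\<^sup>2 + X)
      * ((a - of_int m + (b - of_int n) * (1 - \<epsilon>))\<^sup>2 + Y) < 1"
      using bound[of "a - of_int m" "b - of_int n"] XY_less by linarith
    then show ?thesis by blast
  qed
qed

section \<open>Arithmetic of the ring of integers and its conjugation\<close>

lemma O5_conjE:
  assumes "\<nu> \<in> O5"
  obtains n m :: int where "\<nu> = of_int n + of_int m * \<epsilon>" "K5_conj \<nu> = of_int n + of_int m * (1 - \<epsilon>)"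
proof -
  obtain n m :: int where "\<nu> = of_int n + of_int m * \<epsilon>" using assms unfolding O5_def by blast
  moreover from this have "K5_conj \<nu> = of_int n + of_int m * (1 - \<epsilon>)"
    by (simp only: K5_conj_O5_eps)
  ultimately show ?thesis using that by blast
qed

lemma O5_I:
  assumes "\<nu> = of_int n + of_int m * \<epsilon>"
  shows "\<nu> \<in> O5" and "K5_conj \<nu> = of_int n + of_int m * (1 - \<epsilon>)"
proof -
  show "\<nu> \<in> O5" using assms unfolding O5_def by blast
  show "K5_conj \<nu> = of_int n + of_int m * (1 - \<epsilon>)"
    unfolding assms by (rule K5_conj_O5_eps)
qed

lemma O5_of_int: "of_int n \<in> O5" and K5_conj_of_int: "K5_conj (of_int n) = of_int n"
  using O5_I[of "of_int n" n 0] by simp_all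

lemma O5_1: "1 \<in> O5" and K5_conj_1: "K5_conj 1 = 1"
  using O5_of_int[of 1] K5_conj_of_int[of 1] by simp_all

lemma O5_eps: "\<epsilon> \<in> O5" and K5_conj_eps: "K5_conj \<epsilon> = 1 - \<epsilon>"
  using O5_I[of \<epsilon> 0 1] by simp_all

lemma O5_add:
  assumes "\<mu> \<in> O5" "\<nu> \<in> O5"
  shows "\<mu> + \<nu> \<in> O5" and "K5_conj (\<mu> + \<nu>) = K5_conj \<mu> + K5_conj \<nu>"
proof -
  obtain n m where 1: "\<mu> = of_int n + of_int m * \<epsilon>" "K5_conj \<mu> = of_int n + of_int m * (1 - \<epsilon>)"
    using assms(1) by (rule O5_conjE)
  obtain k l where 2: "\<nu> = of_int k + of_int l * \<epsilon>" "K5_conj \<nu> = of_int k + of_int l * (1 - \<epsilon>)"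
    using assms(2) by (rule O5_conjE)
  have *: "\<mu> + \<nu> = of_int (n + k) + of_int (m + l) * \<epsilon>" by (simp add: 1 2 algebra_simps)
  show "\<mu> + \<nu> \<in> O5" by (rule O5_I(1)[OF *])
  show "K5_conj (\<mu> + \<nu>) = K5_conj \<mu> + K5_conj \<nu>"
    unfolding O5_I(2)[OF *] 1(2) 2(2) by (simp add: algebra_simps)
qed

lemma O5_diff:
  assumes "\<mu> \<in> O5" "\<nu> \<in> O5"
  shows "\<mu> - \<nu> \<in> O5" and "K5_conj (\<mu> - \<nu>) = K5_conj \<mu> - K5_conj \<nu>"
  using O5_add[of \<mu> "- \<nu>"] O5_uminus[OF assms(2)] K5_conj_uminus[OF assms(2)] assms(1) by simp_all

lemma O5_mult:
  assumes "\<mu> \<in> O5" "\<nu> \<in> O5"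
  shows "\<mu> * \<nu> \<in> O5" and "K5_conj (\<mu> * \<nu>) = K5_conj \<mu> * K5_conj \<nu>"
proof -
  obtain n m where 1: "\<mu> = of_int n + of_int m * \<epsilon>" "K5_conj \<mu> = of_int n + of_int m * (1 - \<epsilon>)"
    using assms(1) by (rule O5_conjE)
  obtain k l where 2: "\<nu> = of_int k + of_int l * \<epsilon>" "K5_conj \<nu> = of_int k + of_int l * (1 - \<epsilon>)"
    using assms(2) by (rule O5_conjE)
  have *: "\<mu> * \<nu> = of_int (n * k + m * l) + of_int (n * l + m * k + m * l) * \<epsilon>"
    unfolding 1 2 of_int_add of_int_mult using eps_square by algebra
  show "\<mu> * \<nu> \<in> O5" by (rule O5_I(1)[OF *])
  show "K5_conj (\<mu> * \<nu>) = K5_conj \<mu> * K5_conj \<nu>"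
    unfolding O5_I(2)[OF *] 1(2) 2(2) of_int_add of_int_mult using eps_square by algebra
qed

lemma O5_power:
  assumes "\<nu> \<in> O5"
  shows "\<nu> ^ n \<in> O5 \<and> K5_conj (\<nu> ^ n) = K5_conj \<nu> ^ n"
  by (induction n) (simp_all add: O5_1 K5_conj_1 O5_mult assms)

lemma K5_conj_mem_O5:
  assumes "\<nu> \<in> O5"
  shows "K5_conj \<nu> \<in> O5"
proof -
  obtain n m where "K5_conj \<nu> = of_int n + of_int m * (1 - \<epsilon>)" using assms by (rule O5_conjE)
  then have "K5_conj \<nu> = of_int (n + m) + of_int (- m) * \<epsilon>" by (simp add: algebra_simps)
  then show ?thesis by (rule O5_I)
qed

lemma K5_conj_K5_conj:
  assumes "\<nu> \<in> O5"
  shows "K5_conj (K5_conj \<nu>) = \<nu>"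
proof -
  obtain n m where 1: "\<nu> = of_int n + of_int m * \<epsilon>" "K5_conj \<nu> = of_int n + of_int m * (1 - \<epsilon>)"
    using assms by (rule O5_conjE)
  then have "K5_conj \<nu> = of_int (n + m) + of_int (- m) * \<epsilon>" by (simp add: algebra_simps)
  from O5_I(2)[OF this] show ?thesis unfolding 1(1) by (simp add: algebra_simps)
qed

lemma K5_norm_int:
  assumes "\<nu> \<in> O5"
  obtains k :: int where "\<nu> * K5_conj \<nu> = of_int k"
proof -
  obtain n m where 1: "\<nu> = of_int n + of_int m * \<epsilon>" "K5_conj \<nu> = of_int n + of_int m * (1 - \<epsilon>)"
    using assms by (rule O5_conjE)
  have "\<nu> * K5_conj \<nu> = of_int (n^2 + n * m - m^2)"
    unfolding 1(2) unfolding 1(1) of_int_add of_int_mult of_int_diff of_int_power using eps_square by algebra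
  then show ?thesis using that by blast
qed

lemma K5_conj_eq_0_iff:
  assumes "\<nu> \<in> O5"
  shows "K5_conj \<nu> = 0 \<longleftrightarrow> \<nu> = 0"
  using K5_conj_K5_conj[OF assms] K5_conj_of_int[of 0] by auto

text \<open>The pairs of an integer and its conjugate form a lattice. The difference
  \<open>m * (2 * \<epsilon> - 1)\<close> of the two bounds m by 2 B, and then n is at most 5 B
  because \<epsilon> < 2.\<close>

lemma finite_O5_bounded: "finite {\<nu> \<in> O5. \<bar>\<nu>\<bar> \<le> B \<and> \<bar>K5_conj \<nu>\<bar> \<le> B}"
proof -
  define f :: "int \<times> int \<Rightarrow> real" where "f p = of_int (fst p) + of_int (snd p) * \<epsilon>" for p
  define M where "M = \<lceil>5 * B\<rceil>"
  have "\<nu> \<in> f ` ({- M..M} \<times> {- M..M})" if \<nu>: "\<nu> \<in> O5" "\<bar>\<nu>\<bar> \<le> B" "\<bar>K5_conj \<nu>\<bar> \<le> B" for \<nu>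
  proof -
    obtain n m where 1: "\<nu> = of_int n + of_int m * \<epsilon>" "K5_conj \<nu> = of_int n + of_int m * (1 - \<epsilon>)"
      using \<nu>(1) by (rule O5_conjE)
    have "\<nu> - K5_conj \<nu> = of_int m * (2 * \<epsilon> - 1)"
      unfolding 1(2) unfolding 1(1) by algebra
    then have "\<bar>\<nu> - K5_conj \<nu>\<bar> = \<bar>real_of_int m\<bar> * (2 * \<epsilon> - 1)"
      using eps_gt_1 by (simp add: abs_mult)
    moreover have "\<bar>real_of_int m\<bar> * 1 \<le> \<bar>real_of_int m\<bar> * (2 * \<epsilon> - 1)"
      using eps_gt_1 by (intro mult_left_mono) auto
    ultimately have m: "\<bar>real_of_int m\<bar> \<le> 2 * B" using \<nu> by linarith
    have "\<bar>of_int m * \<epsilon>\<bar> \<le> \<bar>real_of_int m\<bar> * 2"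
      using eps_gt_1 eps_less_2 by (auto simp: abs_mult intro: mult_left_mono)
    then have n: "\<bar>real_of_int n\<bar> \<le> 5 * B" using m \<nu>(2) unfolding 1(1) by linarith
    have "0 \<le> B" using \<nu> by linarith
    then have "\<bar>n\<bar> \<le> M \<and> \<bar>m\<bar> \<le> M" using m n unfolding M_def by linarith
    then show ?thesis by (intro image_eqI[of _ _ "(n, m)"]) (auto simp: f_def 1(1))
  qed
  then have "{\<nu> \<in> O5. \<bar>\<nu>\<bar> \<le> B \<and> \<bar>K5_conj \<nu>\<bar> \<le> B} \<subseteq> f ` ({- M..M} \<times> {- M..M})" by blast
  then show ?thesis by (rule finite_subset) simp
qed

section \<open>Balancing two heights by a unit\<close>

text \<open>The intervals from \<open>q^(2*n - 1)\<close> to \<open>q^(2*n + 1)\<close> cover all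
  numbers from 1 on; the least n whose interval reaches t is taken.\<close>

lemma power_sandwich:
  fixes q t :: real
  assumes "1 < q" "1 \<le> t"
  obtains n where "t \<le> q * (q\<^sup>2) ^ n" "(q\<^sup>2) ^ n \<le> q * t"
proof -
  have ex: "\<exists>n. t \<le> q * (q\<^sup>2) ^ n"
  proof -
    have "1 < q\<^sup>2" using assms by (simp add: one_less_power)
    then obtain n where "t < (q\<^sup>2) ^ n" using real_arch_pow by blast
    moreover have "(q\<^sup>2) ^ n \<le> q * (q\<^sup>2) ^ n" using assms by (intro mult_le_cancel_right1[THEN iffD2]) auto
    ultimately show ?thesis by (intro exI[of _ n]) linarith
  qed
  define n where "n = (LEAST n. t \<le> q * (q\<^sup>2) ^ n)"
  have "t \<le> q * (q\<^sup>2) ^ n" unfolding n_def using ex by (rule LeastI_ex)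
  moreover have "(q\<^sup>2) ^ n \<le> q * t"
  proof (cases n)
    case 0
    have "1 * 1 \<le> q * t" using assms by (intro mult_mono) auto
    then show ?thesis using 0 by simp
  next
    case (Suc k)
    then have "\<not> t \<le> q * (q\<^sup>2) ^ k" unfolding n_def using not_less_Least[of k "\<lambda>n. t \<le> q * (q\<^sup>2) ^ n"] by simp
    then have "q * (q * (q\<^sup>2) ^ k) \<le> q * t" using assms by (intro mult_left_mono) auto
    then show ?thesis by (simp add: Suc power2_eq_square mult.assoc)
  qed
  ultimately show ?thesis by (rule that)
qed

text \<open>Multiplication by the squares of \<open>\<epsilon>^n\<close> and of its conjugate
  changes the ratio of p to r by the factor \<open>\<epsilon>^(4*n)\<close>, so some power brings it
  between \<open>\<epsilon>^(-2)\<close> and \<open>\<epsilon>^2\<close>. The norm is squared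
  because its sign is that of \<open>(-1)^n\<close>.\<close>

lemma unit_scaling:
  fixes p r :: real
  assumes "0 < p" "0 < r"
  obtains c d where "c \<in> O5" "d \<in> O5" "c * d = 1" "K5_conj c * K5_conj d = 1" "(c * K5_conj c)\<^sup>2 = 1"
    "c\<^sup>2 * p \<le> \<epsilon>\<^sup>2 * ((K5_conj c)\<^sup>2 * r)" "(K5_conj c)\<^sup>2 * r \<le> \<epsilon>\<^sup>2 * (c\<^sup>2 * p)"
proof -
  have q: "1 < \<epsilon>\<^sup>2" using eps_gt_1 by (simp add: one_less_power)
  have e1: "\<epsilon> - 1 \<in> O5" "K5_conj (\<epsilon> - 1) = - \<epsilon>"
    using O5_diff[OF O5_eps O5_1] by (simp_all add: K5_conj_eps K5_conj_1)
  have inv: "\<epsilon> * (\<epsilon> - 1) = 1" using eps_square by algebra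
  have sw: "(x ^ n)\<^sup>2 = (x\<^sup>2) ^ n" for x :: real and n :: nat by (metis mult.commute power_mult)
  have key: "\<exists>n. ((1 - \<epsilon>) ^ n)\<^sup>2 * v \<le> \<epsilon>\<^sup>2 * ((\<epsilon> ^ n)\<^sup>2 * u) \<and> (\<epsilon> ^ n)\<^sup>2 * u \<le> \<epsilon>\<^sup>2 * (((1 - \<epsilon>) ^ n)\<^sup>2 * v)"
    if uv: "0 < u" "u \<le> v" for u v
  proof -
    have "1 \<le> v / u" using uv by simp
    then obtain n where n: "v / u \<le> \<epsilon>\<^sup>2 * ((\<epsilon>\<^sup>2)\<^sup>2) ^ n" "((\<epsilon>\<^sup>2)\<^sup>2) ^ n \<le> \<epsilon>\<^sup>2 * (v / u)"
      using power_sandwich[OF q] by metis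
    \<comment> \<open>This is \<open>\<epsilon>^(-2*n)\<close>; multiplying the sandwich by it
      distributes \<open>\<epsilon>^(4*n)\<close> evenly over both sides.\<close>
    define w where "w = ((1 - \<epsilon>) ^ n)\<^sup>2"
    have w0: "0 \<le> w" by (simp add: w_def)
    have "w * ((\<epsilon>\<^sup>2)\<^sup>2) ^ n = (((1 - \<epsilon>)\<^sup>2 * (\<epsilon>\<^sup>2)) * \<epsilon>\<^sup>2) ^ n"
      unfolding w_def sw[of "1 - \<epsilon>"] power_mult_distrib[symmetric] power2_eq_square[of "\<epsilon>\<^sup>2"] mult.assoc ..
    also have "(1 - \<epsilon>)\<^sup>2 * \<epsilon>\<^sup>2 = 1" using inv by algebra
    finally have w: "w * ((\<epsilon>\<^sup>2)\<^sup>2) ^ n = (\<epsilon> ^ n)\<^sup>2" by (simp add: sw[of _ n])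
    have "w * v \<le> w * (\<epsilon>\<^sup>2 * ((\<epsilon>\<^sup>2)\<^sup>2) ^ n * u)"
      using n(1) uv w0 by (intro mult_left_mono) (auto simp: field_simps)
    moreover have "w * ((\<epsilon>\<^sup>2)\<^sup>2) ^ n * u \<le> w * (\<epsilon>\<^sup>2 * v)"
      unfolding mult.assoc using n(2) uv w0 by (intro mult_left_mono) (auto simp: field_simps)
    ultimately have "w * v \<le> \<epsilon>\<^sup>2 * ((\<epsilon> ^ n)\<^sup>2 * u)" "(\<epsilon> ^ n)\<^sup>2 * u \<le> \<epsilon>\<^sup>2 * (w * v)"
      unfolding w[symmetric] by (simp_all add: mult_ac)
    then show ?thesis unfolding w_def by blast
  qed
  show ?thesis
  proof (cases "p \<le> r")
    case True
    obtain n where n: "((1 - \<epsilon>) ^ n)\<^sup>2 * r \<le> \<epsilon>\<^sup>2 * ((\<epsilon> ^ n)\<^sup>2 * p)"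
      "(\<epsilon> ^ n)\<^sup>2 * p \<le> \<epsilon>\<^sup>2 * (((1 - \<epsilon>) ^ n)\<^sup>2 * r)" using key[OF assms(1) True] by blast
    have "\<epsilon> ^ n * (\<epsilon> - 1) ^ n = 1" "(1 - \<epsilon>) ^ n * (- \<epsilon>) ^ n = 1"
      using inv by (simp_all add: power_mult_distrib[symmetric] algebra_simps)
    moreover have "(\<epsilon> ^ n * (1 - \<epsilon>) ^ n)\<^sup>2 = 1"
    proof -
      have "\<epsilon> * (1 - \<epsilon>) = - 1" using inv by algebra
      then have "\<epsilon> ^ n * (1 - \<epsilon>) ^ n = (- 1) ^ n" by (simp add: power_mult_distrib[symmetric])
      then show ?thesis by (simp add: sw[of _ n])
    qed
    ultimately show ?thesis
      using n O5_power[OF O5_eps, of n] O5_power[OF e1(1), of n]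
      by (intro that[of "\<epsilon> ^ n" "(\<epsilon> - 1) ^ n"]) (simp_all add: K5_conj_eps e1)
  next
    \<comment> \<open>Now the unit is a power of the inverse of \<epsilon>, so that the second
      coordinate receives the growing factor.\<close>
    case False
    obtain n where n: "((1 - \<epsilon>) ^ n)\<^sup>2 * p \<le> \<epsilon>\<^sup>2 * ((\<epsilon> ^ n)\<^sup>2 * r)"
      "(\<epsilon> ^ n)\<^sup>2 * r \<le> \<epsilon>\<^sup>2 * (((1 - \<epsilon>) ^ n)\<^sup>2 * p)" using key[of r p] False assms by auto
    have sq: "((\<epsilon> - 1) ^ n)\<^sup>2 = ((1 - \<epsilon>) ^ n)\<^sup>2" "((- \<epsilon>) ^ n)\<^sup>2 = (\<epsilon> ^ n)\<^sup>2"
      by (simp_all add: sw[of _ n] power2_commute)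
    have "(\<epsilon> - 1) ^ n * \<epsilon> ^ n = 1" "(- \<epsilon>) ^ n * (1 - \<epsilon>) ^ n = 1"
      using inv by (simp_all add: power_mult_distrib[symmetric] algebra_simps)
    moreover have "((\<epsilon> - 1) ^ n * (- \<epsilon>) ^ n)\<^sup>2 = 1"
    proof -
      have "(\<epsilon> - 1) * (- \<epsilon>) = - 1" using inv by algebra
      then have "(\<epsilon> - 1) ^ n * (- \<epsilon>) ^ n = (- 1) ^ n" by (simp add: power_mult_distrib[symmetric])
      then show ?thesis by (simp add: sw[of _ n])
    qed
    ultimately show ?thesis
      using n O5_power[OF O5_eps, of n] O5_power[OF e1(1), of n]
      by (intro that[of "(\<epsilon> - 1) ^ n" "\<epsilon> ^ n"]) (simp_all add: K5_conj_eps e1 sq)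
  qed
qed

section \<open>Elliptic fixed points\<close>

text \<open>Fixed points are the roots of \<open>c * w^2 + (d - a) * w - b\<close>, whose
  discriminant is the squared trace minus 4. A non-real root has real part
  \<open>(a - d) / (2 * c)\<close>; its height comes from the discriminant.\<close>

lemma frac_lin_fixed_iff:
  fixes M :: mat2 and w :: complex
  assumes "M $ 1 $ 1 * M $ 2 $ 2 - M $ 1 $ 2 * M $ 2 $ 1 = 1" "0 < Im w" "(trace M)\<^sup>2 \<noteq> 4"
  shows "frac_lin M w = w \<longleftrightarrow> 2 * M $ 2 $ 1 * Re w = M $ 1 $ 1 - M $ 2 $ 2
    \<and> 4 * (M $ 2 $ 1)\<^sup>2 * (Im w)\<^sup>2 = 4 - (trace M)\<^sup>2"
proof -
  define a b c d where abcd: "a = M $ 1 $ 1" "b = M $ 1 $ 2" "c = M $ 2 $ 1" "d = M $ 2 $ 2"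
  define x y where xy: "x = Re w" "y = Im w"
  have w: "w = Complex x y" by (simp add: xy)
  have det: "a * d - b * c = 1" using assms(1) by (simp add: abcd)
  have y: "0 < y" using assms(2) by (simp add: xy)
  have tr: "trace M = a + d" by (simp add: trace_def sum_2 abcd)
  have tr4: "(a + d)\<^sup>2 \<noteq> 4" using assms(3) by (simp add: tr)
  have nz: "of_real c * w + of_real d \<noteq> 0"
  proof
    assume "of_real c * w + of_real d = 0"
    then have "c * x + d = 0" "c * y = 0" by (simp_all add: w complex_eq_iff)
    then have "c = 0" "d = 0" using y by auto
    then show False using det by simp
  qed
  have "frac_lin M w = w \<longleftrightarrow> of_real a * w + of_real b = w * (of_real c * w + of_real d)"
    unfolding frac_lin_def abcd[symmetric] using nz by (simp add: divide_eq_eq)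
  also have "\<dots> \<longleftrightarrow> a * x + b = x * (c * x + d) - y * (c * y) \<and> a * y = x * (c * y) + y * (c * x + d)"
    by (simp add: w complex_eq_iff)
  also have "\<dots> \<longleftrightarrow> 2 * c * x = a - d \<and> 4 * c\<^sup>2 * y\<^sup>2 = 4 - (a + d)\<^sup>2" (is "?L \<longleftrightarrow> ?R")
  proof
    assume L: ?L
    then have "y * (2 * c * x - (a - d)) = 0" by algebra
    then have 1: "2 * c * x = a - d" using y by simp
    have "4 * c\<^sup>2 * y\<^sup>2 = 4 - (a + d)\<^sup>2" using L 1 det by algebra
    with 1 show ?R by simp
  next
    assume R: ?R
    have c: "c \<noteq> 0"
    proof
      assume "c = 0"
      moreover have "4 * c\<^sup>2 * y\<^sup>2 = 4 - (a + d)\<^sup>2" using R by blast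
      ultimately show False using tr4 by simp
    qed
    have "4 * c * (a * x + b - (x * (c * x + d) - y * (c * y))) = 0" using R det by algebra
    then have "a * x + b = x * (c * x + d) - y * (c * y)" using c by simp
    moreover have "a * y = x * (c * y) + y * (c * x + d)" using R by algebra
    ultimately show ?L by simp
  qed
  finally show ?thesis unfolding tr abcd xy by simp
qed

text \<open>\<open>\<epsilon> - 1\<close> is \<open>inverse \<epsilon>\<close>, in the form of an
  element of \<open>O5\<close>.\<close>

definition special_trace :: "real \<Rightarrow> bool" where
  "special_trace t \<longleftrightarrow> t = \<epsilon> \<or> t = \<epsilon> - 1"

text \<open>Real and imaginary parts of the equations for \<open>z\<close> to be fixed by a matrix with first column
  \<open>(e, c)\<close> and trace \<open>t\<close>.\<close>

definition elliptic_fixed :: "real \<Rightarrow> real \<Rightarrow> real \<Rightarrow> complex \<times> complex \<Rightarrow> bool" where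
  "elliptic_fixed c e t z \<longleftrightarrow>
     2 * c * Re (fst z) = 2 * e - t \<and> 2 * K5_conj c * Re (snd z) = 2 * K5_conj e - K5_conj t \<and>
     4 * c\<^sup>2 * (Im (fst z))\<^sup>2 = 4 - t\<^sup>2 \<and> 4 * (K5_conj c)\<^sup>2 * (Im (snd z))\<^sup>2 = 4 - (K5_conj t)\<^sup>2"

text \<open>Conjugation sends \<epsilon> to \<open>- inverse \<epsilon>\<close> and
  \<open>inverse \<epsilon>\<close> to \<open>- \<epsilon>\<close>, so both traces yield the same
  two factors. Their product 5 is the source of \<open>sqrt 5 / 4\<close>.\<close>

lemma special_trace_props:
  assumes "special_trace t"
  shows "t \<in> O5" "\<bar>t\<bar> < 2" "\<bar>K5_conj t\<bar> < 2" "(4 - t\<^sup>2) * (4 - (K5_conj t)\<^sup>2) = 5"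
proof -
  have e1: "\<epsilon> - 1 \<in> O5" "K5_conj (\<epsilon> - 1) = - \<epsilon>"
    using O5_diff[OF O5_eps O5_1] by (simp_all add: K5_conj_eps K5_conj_1)
  have t: "t = \<epsilon> \<and> K5_conj t = 1 - \<epsilon> \<or> t = \<epsilon> - 1 \<and> K5_conj t = - \<epsilon>"
    using assms e1 K5_conj_eps by (auto simp: special_trace_def)
  show "t \<in> O5" using assms e1 O5_eps by (auto simp: special_trace_def)
  show "\<bar>t\<bar> < 2" "\<bar>K5_conj t\<bar> < 2" using t eps_gt_1 eps_less_2 by auto
  have "(4 - \<epsilon>\<^sup>2) * (4 - (1 - \<epsilon>)\<^sup>2) = 5" using eps_square by algebra
  then show "(4 - t\<^sup>2) * (4 - (K5_conj t)\<^sup>2) = 5" using t by (auto simp: power2_commute mult.commute)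
qed

text \<open>A matrix of trace t has lower right entry \<open>t - a\<close>. The fixed point
  criterion for it and for its conjugate replaces the group by equations in
  \<open>O5\<close>.\<close>

lemma special_elliptic_point_iff:
  assumes "z \<in> H2"
  shows "special_elliptic_point z \<longleftrightarrow> (\<exists>a b c t. a \<in> O5 \<and> b \<in> O5 \<and> c \<in> O5 \<and> special_trace t \<and>
    a * (t - a) - b * c = 1 \<and> elliptic_fixed c a t z)"
proof
  assume "special_elliptic_point z"
  then obtain \<gamma> A where \<gamma>: "\<gamma> \<in> Hilbert_modular_group" and te: "totally_elliptic \<gamma>"
    and fixed: "Hilbert_act \<gamma> z = z" and A: "A \<in> fst \<gamma>" and tr: "trace A = \<epsilon> \<or> trace A = inverse \<epsilon>"
    unfolding special_elliptic_point_def by blast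
  have AS: "A \<in> SL2_O5" using \<gamma> A SL2_O5_uminus unfolding Hilbert_modular_group_eq by auto
  then have O: "\<And>i j. A $ i $ j \<in> O5" and det: "A $ 1 $ 1 * A $ 2 $ 2 - A $ 1 $ 2 * A $ 2 $ 1 = 1"
    by (auto simp: SL2_O5_def det_2)
  define t where "t = trace A"
  have t: "special_trace t" using tr inverse_eps by (auto simp: t_def special_trace_def)
  have tA: "t = A $ 1 $ 1 + A $ 2 $ 2" by (simp add: t_def trace_def sum_2)
  have trc: "trace (conj_mat A) = K5_conj t"
    unfolding tA by (simp add: trace_def sum_2 conj_mat_def O5_add O)
  have detc: "conj_mat A $ 1 $ 1 * conj_mat A $ 2 $ 2 - conj_mat A $ 1 $ 2 * conj_mat A $ 2 $ 1 = 1"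
    using arg_cong[OF det, of K5_conj] O by (simp add: conj_mat_def O5_diff O5_mult K5_conj_1)
  have sq: "t\<^sup>2 \<noteq> 4" "(K5_conj t)\<^sup>2 \<noteq> 4"
    using special_trace_props(4)[OF t] by auto
  have "frac_lin A (fst z) = fst z" "frac_lin (conj_mat A) (snd z) = snd z"
    using fixed Hilbert_act_eq[OF \<gamma> A, of z] by (metis fst_conv, metis snd_conv)
  then have *: "2 * A $ 2 $ 1 * Re (fst z) = A $ 1 $ 1 - A $ 2 $ 2"
    "4 * (A $ 2 $ 1)\<^sup>2 * (Im (fst z))\<^sup>2 = 4 - t\<^sup>2"
    "2 * K5_conj (A $ 2 $ 1) * Re (snd z) = K5_conj (A $ 1 $ 1) - K5_conj (A $ 2 $ 2)"
    "4 * (K5_conj (A $ 2 $ 1))\<^sup>2 * (Im (snd z))\<^sup>2 = 4 - (K5_conj t)\<^sup>2"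
    using frac_lin_fixed_iff[OF det, of "fst z"] frac_lin_fixed_iff[OF detc, of "snd z"] assms sq
    unfolding trc t_def[symmetric] by (auto simp: H2_def conj_mat_def)
  have "K5_conj (A $ 2 $ 2) = K5_conj t - K5_conj (A $ 1 $ 1)"
    unfolding tA by (simp add: O5_add O)
  then have "elliptic_fixed (A $ 2 $ 1) (A $ 1 $ 1) t z"
    unfolding elliptic_fixed_def using * tA by simp
  moreover have "A $ 1 $ 1 * (t - A $ 1 $ 1) - A $ 1 $ 2 * A $ 2 $ 1 = 1" using det tA by simp
  ultimately show "\<exists>a b c t. a \<in> O5 \<and> b \<in> O5 \<and> c \<in> O5 \<and> special_trace t \<and>
    a * (t - a) - b * c = 1 \<and> elliptic_fixed c a t z" using O t by blast
next
  assume "\<exists>a b c t. a \<in> O5 \<and> b \<in> O5 \<and> c \<in> O5 \<and> special_trace t \<and>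
    a * (t - a) - b * c = 1 \<and> elliptic_fixed c a t z"
  then obtain a b c t where O: "a \<in> O5" "b \<in> O5" "c \<in> O5" and t: "special_trace t"
    and det: "a * (t - a) - b * c = 1" and fixed: "elliptic_fixed c a t z" by blast
  note tO = special_trace_props(1)[OF t]
  define A :: mat2 where "A = vector [vector [a, b], vector [c, t - a]]"
  have A: "A $ 1 $ 1 = a" "A $ 1 $ 2 = b" "A $ 2 $ 1 = c" "A $ 2 $ 2 = t - a"
    by (simp_all add: A_def vector_2)
  have AS: "A \<in> SL2_O5"
    using O O5_diff(1)[OF tO O(1)] det by (simp add: SL2_O5_def forall_2 A det_2)
  define \<gamma> where "\<gamma> = ({A, - A}, {conj_mat A, - conj_mat A})"
  have \<gamma>: "\<gamma> \<in> Hilbert_modular_group" unfolding Hilbert_modular_group_eq \<gamma>_def using AS by blast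
  have tr: "trace A = t" by (simp add: trace_def sum_2 A)
  have trc: "trace (conj_mat A) = K5_conj t"
    using O5_diff[OF tO O(1)] by (simp add: trace_def sum_2 conj_mat_def A)
  have trm: "trace (- B) = - trace B" for B :: mat2
    by (simp add: trace_def sum_2)
  have te: "totally_elliptic \<gamma>"
    using special_trace_props[OF t] by (simp add: totally_elliptic_def \<gamma>_def trm tr trc)
  have detA: "A $ 1 $ 1 * A $ 2 $ 2 - A $ 1 $ 2 * A $ 2 $ 1 = 1" using det by (simp add: A)
  have detc: "conj_mat A $ 1 $ 1 * conj_mat A $ 2 $ 2 - conj_mat A $ 1 $ 2 * conj_mat A $ 2 $ 1 = 1"
    using arg_cong[OF det, of K5_conj] O tO by (simp add: conj_mat_def A O5_diff O5_mult K5_conj_1)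
  have sq: "t\<^sup>2 \<noteq> 4" "(K5_conj t)\<^sup>2 \<noteq> 4"
    using special_trace_props(4)[OF t] by auto
  have "frac_lin A (fst z) = fst z" "frac_lin (conj_mat A) (snd z) = snd z"
    using frac_lin_fixed_iff[OF detA, of "fst z"] frac_lin_fixed_iff[OF detc, of "snd z"] assms sq fixed
    unfolding tr trc by (auto simp: H2_def conj_mat_def A elliptic_fixed_def O5_diff O tO)
  then have "Hilbert_act \<gamma> z = z"
    using Hilbert_act_eq[OF \<gamma>, of A z] by (simp add: \<gamma>_def)
  moreover have "trace A = \<epsilon> \<or> trace A = inverse \<epsilon>"
    using t unfolding tr inverse_eps special_trace_def .
  ultimately show "special_elliptic_point z"
    unfolding special_elliptic_point_def using \<gamma> te by (auto simp: \<gamma>_def)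
qed

text \<open>Multiplying the two height equations produces the squared norm of c on the left and 5 on
  the right.\<close>

lemma elliptic_fixed_height:
  assumes "c \<in> O5" "special_trace t" "elliptic_fixed c e t z" "z \<in> H2"
  shows "c \<noteq> 0" "\<bar>c * K5_conj c\<bar> * (Im (fst z) * Im (snd z)) = sqrt 5 / 4"
proof -
  have "16 * (c * K5_conj c * (Im (fst z) * Im (snd z)))\<^sup>2
      = (4 * c\<^sup>2 * (Im (fst z))\<^sup>2) * (4 * (K5_conj c)\<^sup>2 * (Im (snd z))\<^sup>2)"
    by algebra
  also have "\<dots> = 5"
    using assms(3) special_trace_props(4)[OF assms(2)] unfolding elliptic_fixed_def by simp
  finally have *: "16 * (c * K5_conj c * (Im (fst z) * Im (snd z)))\<^sup>2 = 5" .
  then show "c \<noteq> 0" by auto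
  have "(\<bar>c * K5_conj c\<bar> * (Im (fst z) * Im (snd z)))\<^sup>2 = (sqrt 5 / 4)\<^sup>2"
    using * by (simp add: power_mult_distrib power_divide)
  moreover have "0 \<le> \<bar>c * K5_conj c\<bar> * (Im (fst z) * Im (snd z))"
    using assms(4) by (simp add: H2_def)
  ultimately show "\<bar>c * K5_conj c\<bar> * (Im (fst z) * Im (snd z)) = sqrt 5 / 4"
    by (rule_tac power2_eq_imp_eq) auto
qed

text \<open>The norm of c is a nonzero integer, hence at least 1 in absolute value.\<close>

lemma special_elliptic_height_le:
  assumes "c \<in> O5" "special_trace t" "elliptic_fixed c e t z" "z \<in> H2"
  shows "Im (fst z) * Im (snd z) \<le> sqrt 5 / 4"
proof -
  obtain k :: int where k: "c * K5_conj c = of_int k" using assms(1) by (rule K5_norm_int)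
  have "c * K5_conj c \<noteq> 0"
    using elliptic_fixed_height(1)[OF assms] K5_conj_eq_0_iff[OF assms(1)] by simp
  then have "1 \<le> \<bar>c * K5_conj c\<bar>" unfolding k by simp
  moreover have "0 \<le> Im (fst z) * Im (snd z)" using assms(4) by (simp add: H2_def)
  ultimately have "1 * (Im (fst z) * Im (snd z)) \<le> \<bar>c * K5_conj c\<bar> * (Im (fst z) * Im (snd z))"
    by (rule mult_right_mono)
  then show ?thesis using elliptic_fixed_height(2)[OF assms] by simp
qed

text \<open>For a unit c the determinant condition can be solved for the upper right entry, whatever
  e is.\<close>

lemma special_elliptic_point_unit:
  assumes "z \<in> H2" "e \<in> O5" "c \<in> O5" "d \<in> O5" "c * d = 1" "special_trace t" "elliptic_fixed c e t z"
  shows "special_elliptic_point z"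
proof -
  note tO = special_trace_props(1)[OF assms(6)]
  have "(e * (t - e) - 1) * d \<in> O5"
    using assms tO by (intro O5_mult O5_diff O5_1)
  moreover have "e * (t - e) - (e * (t - e) - 1) * d * c = 1"
    using assms(5) by algebra
  ultimately show ?thesis
    unfolding special_elliptic_point_iff[OF assms(1)] using assms by blast
qed

section \<open>Translates of points of small height\<close>

lemma cmod_mult_sq: "(cmod (u * v))\<^sup>2 = ((Re u)\<^sup>2 + (Im u)\<^sup>2) * ((Re v)\<^sup>2 + (Im v)\<^sup>2)"
  by (simp add: norm_mult power_mult_distrib cmod_power2)

text \<open>The reason is \<open>5 * \<epsilon>^2 = (\<epsilon> + 2)^2\<close>. The two values are 4
  minus the squares of \<open>\<epsilon> - 1\<close> and \<epsilon>, as the height equations of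
  \<open>elliptic_fixed\<close> demand.\<close>

lemma deep_hole_heights:
  fixes X Y :: real
  assumes "0 < Y" "X = \<epsilon>\<^sup>2 * Y" "X * Y = 5 / 16"
  shows "4 * X = \<epsilon> + 2" "4 * Y = 3 - \<epsilon>"
proof -
  have "(4 * X)\<^sup>2 = 16 * (X * X)" by (simp add: power2_eq_square)
  also have "X * X = \<epsilon>\<^sup>2 * (X * Y)" by (subst (2) assms(2)) simp
  also have "16 * (\<epsilon>\<^sup>2 * (X * Y)) = (\<epsilon> + 2)\<^sup>2"
    unfolding assms(3) eps_square power2_sum by simp
  finally have "(4 * X)\<^sup>2 = (\<epsilon> + 2)\<^sup>2" .
  then show X: "4 * X = \<epsilon> + 2"
  proof (rule power2_eq_imp_eq)
    show "0 \<le> 4 * X" using assms(1) unfolding assms(2) by simp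
    show "0 \<le> \<epsilon> + 2" using eps_gt_1 by simp
  qed
  have "\<epsilon>\<^sup>2 * (4 * Y) = \<epsilon> + 2" using X unfolding assms(2) by simp
  also have "\<dots> = \<epsilon>\<^sup>2 * (3 - \<epsilon>)" using eps_square by algebra
  finally show "4 * Y = 3 - \<epsilon>" using eps_gt_1 by simp
qed

text \<open>A unit c balances the heights, \<open>lattice_point_below_1\<close> moves the scaled
  real parts, and division by c returns a translation of z. The exceptional case of that lemma is
  recognised as a special elliptic point.\<close>

lemma N5_orbit_below_1:
  assumes z: "z \<in> H2" and le: "Im (fst z) * Im (snd z) \<le> sqrt 5 / 4"
    and not_special: "\<not> (Im (fst z) * Im (snd z) = sqrt 5 / 4 \<and> special_elliptic_point z)"
  shows "\<exists>w \<in> N5_orbit z. cmod (fst w * snd w) < 1"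
proof -
  define x1 x2 y1 y2 where xy: "x1 = Re (fst z)" "x2 = Re (snd z)" "y1 = Im (fst z)" "y2 = Im (snd z)"
  have y: "0 < y1" "0 < y2" using z by (simp_all add: H2_def xy)
  then obtain c d where c: "c \<in> O5" and d: "d \<in> O5" and cd: "c * d = 1" "K5_conj c * K5_conj d = 1"
    and norm: "(c * K5_conj c)\<^sup>2 = 1"
    and scale: "c\<^sup>2 * y1\<^sup>2 \<le> \<epsilon>\<^sup>2 * ((K5_conj c)\<^sup>2 * y2\<^sup>2)" "(K5_conj c)\<^sup>2 * y2\<^sup>2 \<le> \<epsilon>\<^sup>2 * (c\<^sup>2 * y1\<^sup>2)"
    using unit_scaling[of "y1\<^sup>2" "y2\<^sup>2"] by (metis zero_less_power)
  define c' where "c' = K5_conj c"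
  define X Y where XY: "X = c\<^sup>2 * y1\<^sup>2" "Y = c'\<^sup>2 * y2\<^sup>2"
  have nz: "c \<noteq> 0" "c' \<noteq> 0" using cd unfolding c'_def by auto
  have pos: "0 < X" "0 < Y" using y nz by (simp_all add: XY)
  have prod: "X * Y = (y1 * y2)\<^sup>2" unfolding XY using norm[folded c'_def] by algebra
  have "(y1 * y2)\<^sup>2 \<le> (sqrt 5 / 4)\<^sup>2" using le y by (intro power_mono) (auto simp: xy)
  then have prod_le: "X * Y \<le> 5 / 16" unfolding prod by (simp add: power_divide)
  have prod_eq: "y1 * y2 = sqrt 5 / 4" if "X * Y = 5 / 16"
  proof (rule power2_eq_imp_eq)
    show "(y1 * y2)\<^sup>2 = (sqrt 5 / 4)\<^sup>2" using that unfolding prod by (simp add: power_divide)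
  qed (use y in auto)
  \<comment> \<open>Coordinates of the scaled real parts in the basis 1, \<epsilon>; the denominator
    is \<open>sqrt 5\<close>.\<close>
  define b a where "b = (c * x1 - c' * x2) / (2 * \<epsilon> - 1)" and "a = c * x1 - b * \<epsilon>"
  have "b * (2 * \<epsilon> - 1) = c * x1 - c' * x2" unfolding b_def using eps_gt_1 by simp
  then have ab: "c * x1 = a + b * \<epsilon>" "c' * x2 = a + b * (1 - \<epsilon>)"
    unfolding a_def by (simp_all add: algebra_simps)
  have "\<exists>m n :: int. ((c * x1 - (of_int m + of_int n * \<epsilon>))\<^sup>2 + X)
      * ((c' * x2 - (of_int m + of_int n * (1 - \<epsilon>)))\<^sup>2 + Y) < 1"
  proof (cases "Y \<le> X")
    case True
    have "X * Y \<noteq> 5 / 16 \<or> X \<noteq> \<epsilon>\<^sup>2 * Y \<or> a - 1/2 \<notin> \<int> \<or> b - 1/2 \<notin> \<int>"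
    proof (rule ccontr)
      assume "\<not> ?thesis"
      then obtain k l :: int where h: "X * Y = 5 / 16" "X = \<epsilon>\<^sup>2 * Y" "a - 1/2 = of_int k" "b - 1/2 = of_int l"
        unfolding Ints_def by blast
      note hh = deep_hole_heights[OF pos(2) h(2,1)]
      \<comment> \<open>As a = k + 1/2 and b = l + 1/2, this choice makes
        \<open>2 * (a + b * \<epsilon>)\<close> equal to \<open>2 * e - t\<close> with trace
        \<open>t = \<epsilon> - 1\<close>.\<close>
      define e where "e = of_int k + of_int (l + 1) * \<epsilon>"
      have e: "e \<in> O5" "K5_conj e = of_int k + of_int (l + 1) * (1 - \<epsilon>)"
        using O5_I[OF e_def] .
      have t: "K5_conj (\<epsilon> - 1) = - \<epsilon>"
        using O5_diff(2)[OF O5_eps O5_1] by (simp add: K5_conj_eps K5_conj_1)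
      have "2 * (c * x1) = 2 * e - (\<epsilon> - 1)" "2 * (c' * x2) = 2 * K5_conj e - (- \<epsilon>)"
        unfolding ab e(2) unfolding e_def using h(3,4) by (simp_all add: field_simps)
      moreover have "4 * X = 4 - (\<epsilon> - 1)\<^sup>2" "4 * Y = 4 - (- \<epsilon>)\<^sup>2"
        using hh eps_square by algebra+
      ultimately have "elliptic_fixed c e (\<epsilon> - 1) z"
        unfolding elliptic_fixed_def t xy[symmetric] c'_def[symmetric] by (simp add: XY mult.assoc)
      then have "special_elliptic_point z"
        by (intro special_elliptic_point_unit[OF z e(1) c d cd(1)]) (simp_all add: special_trace_def)
      then show False using not_special prod_eq[OF h(1)] by (simp add: xy)
    qed
    then obtain m n :: int where "((a - of_int m + (b - of_int n) * \<epsilon>)\<^sup>2 + X)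
      * ((a - of_int m + (b - of_int n) * (1 - \<epsilon>))\<^sup>2 + Y) < 1"
      using lattice_point_below_1[OF pos(2) True scale(1)[folded c'_def, folded XY] prod_le] by blast
    moreover have "a - of_int m + (b - of_int n) * \<epsilon> = c * x1 - (of_int m + of_int n * \<epsilon>)"
      "a - of_int m + (b - of_int n) * (1 - \<epsilon>) = c' * x2 - (of_int m + of_int n * (1 - \<epsilon>))"
      unfolding ab by (simp_all add: algebra_simps)
    ultimately have "((c * x1 - (of_int m + of_int n * \<epsilon>))\<^sup>2 + X)
      * ((c' * x2 - (of_int m + of_int n * (1 - \<epsilon>)))\<^sup>2 + Y) < 1" by simp
    then show ?thesis by blast
  next
    case False
    \<comment> \<open>The coordinates of the point are interchanged:
      \<open>a + b * (1 - \<epsilon>)\<close> has coordinates \<open>a + b\<close> and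
      \<open>- b\<close> in the basis 1, \<epsilon>.\<close>
    have "Y * X \<noteq> 5 / 16 \<or> Y \<noteq> \<epsilon>\<^sup>2 * X \<or> a + b - 1/2 \<notin> \<int> \<or> - b - 1/2 \<notin> \<int>"
    proof (rule ccontr)
      assume "\<not> ?thesis"
      then obtain k l :: int where h: "Y * X = 5 / 16" "Y = \<epsilon>\<^sup>2 * X" "a + b - 1/2 = of_int k" "- b - 1/2 = of_int l"
        unfolding Ints_def by blast
      note hh = deep_hole_heights[OF pos(1) h(2,1)]
      \<comment> \<open>Now a is an integer and b a half-integer, which leads to the trace
        \<epsilon>.\<close>
      define e where "e = of_int (k + l + 1) + of_int (- l) * \<epsilon>"
      have e: "e \<in> O5" "K5_conj e = of_int (k + l + 1) + of_int (- l) * (1 - \<epsilon>)"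
        using O5_I[OF e_def] .
      have b: "b = - of_int l - 1/2" and a: "a = of_int k + of_int l + 1" using h(3,4) by linarith+
      have "2 * (c * x1) = 2 * e - \<epsilon>" "2 * (c' * x2) = 2 * K5_conj e - (1 - \<epsilon>)"
        unfolding ab e(2) unfolding e_def a b by (simp_all add: field_simps)
      moreover have "4 * X = 4 - \<epsilon>\<^sup>2" "4 * Y = 4 - (1 - \<epsilon>)\<^sup>2"
        using hh eps_square by algebra+
      ultimately have "elliptic_fixed c e \<epsilon> z"
        unfolding elliptic_fixed_def K5_conj_eps xy[symmetric] c'_def[symmetric] by (simp add: XY mult.assoc)
      then have "special_elliptic_point z"
        by (intro special_elliptic_point_unit[OF z e(1) c d cd(1)]) (simp_all add: special_trace_def)
      then show False using not_special prod_eq h(1) by (simp add: xy mult.commute)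
    qed
    then obtain m n :: int where "((a + b - of_int m + (- b - of_int n) * \<epsilon>)\<^sup>2 + Y)
      * ((a + b - of_int m + (- b - of_int n) * (1 - \<epsilon>))\<^sup>2 + X) < 1"
      using lattice_point_below_1[OF pos(1) _ scale(2)[folded c'_def, folded XY] prod_le[unfolded mult.commute[of X]]] False
      by (metis linear)
    moreover have "a + b - of_int m + (- b - of_int n) * \<epsilon>
        = c' * x2 - (of_int (m + n) + of_int (- n) * (1 - \<epsilon>))"
      "a + b - of_int m + (- b - of_int n) * (1 - \<epsilon>) = c * x1 - (of_int (m + n) + of_int (- n) * \<epsilon>)"
      unfolding ab by (simp_all add: algebra_simps)
    ultimately have "((c * x1 - (of_int (m + n) + of_int (- n) * \<epsilon>))\<^sup>2 + X)
      * ((c' * x2 - (of_int (m + n) + of_int (- n) * (1 - \<epsilon>)))\<^sup>2 + Y) < 1"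
      by (simp only: mult.commute)
    then show ?thesis by blast
  qed
  then obtain m n :: int where small: "((c * x1 - (of_int m + of_int n * \<epsilon>))\<^sup>2 + X)
      * ((c' * x2 - (of_int m + of_int n * (1 - \<epsilon>)))\<^sup>2 + Y) < 1" by blast
  define \<mu> where "\<mu> = of_int m + of_int n * \<epsilon>"
  have \<mu>: "\<mu> \<in> O5" "K5_conj \<mu> = of_int m + of_int n * (1 - \<epsilon>)"
    using O5_I[OF \<mu>_def] .
  \<comment> \<open>Dividing by c undoes the scaling; the product is unchanged since the norm of c
    has square 1.\<close>
  define \<nu> where "\<nu> = - (\<mu> * d)"
  have \<nu>: "\<nu> \<in> O5" "K5_conj \<nu> = - (K5_conj \<mu> * K5_conj d)"
    unfolding \<nu>_def using O5_mult[OF \<mu>(1) d] by (simp_all add: O5_uminus K5_conj_uminus)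
  define w where "w = (fst z + of_real \<nu>, snd z + of_real (K5_conj \<nu>))"
  have "(cmod (fst w * snd w))\<^sup>2 = ((x1 + \<nu>)\<^sup>2 + y1\<^sup>2) * ((x2 + K5_conj \<nu>)\<^sup>2 + y2\<^sup>2)"
    unfolding cmod_mult_sq by (simp add: w_def xy)
  also have "\<dots> = (c\<^sup>2 * ((x1 + \<nu>)\<^sup>2 + y1\<^sup>2)) * (c'\<^sup>2 * ((x2 + K5_conj \<nu>)\<^sup>2 + y2\<^sup>2))"
    using norm[folded c'_def] by algebra
  also have "c\<^sup>2 * ((x1 + \<nu>)\<^sup>2 + y1\<^sup>2) = (c * x1 - \<mu>)\<^sup>2 + X"
    unfolding \<nu>_def XY using cd(1) by algebra
  also have "c'\<^sup>2 * ((x2 + K5_conj \<nu>)\<^sup>2 + y2\<^sup>2) = (c' * x2 - K5_conj \<mu>)\<^sup>2 + Y"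
    unfolding \<nu>(2) XY using cd(2)[folded c'_def] by algebra
  also have "((c * x1 - \<mu>)\<^sup>2 + X) * ((c' * x2 - K5_conj \<mu>)\<^sup>2 + Y) < 1"
    using small unfolding \<mu>(2) unfolding \<mu>_def .
  finally have "cmod (fst w * snd w) < 1"
    by (simp add: power_less_one_iff)
  moreover have "w \<in> N5_orbit z" unfolding N5_orbit_def w_def using \<nu>(1) by blast
  ultimately show ?thesis by blast
qed

section \<open>Chosen points, orbits of fixed points, and bounds in Goetzky's domain\<close>

lemma N5_orbit_self: "z \<in> N5_orbit z"
  unfolding N5_orbit_def using O5_of_int[of 0] K5_conj_of_int[of 0] by (auto intro!: exI[of _ 0])

text \<open>A point lies in its own orbit, so a point of \<open>S\<close> is the one chosen from
  it.\<close>

lemma is_S5_minimal: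
  assumes "is_S5 S" "z \<in> S"
  shows "z \<in> H2" "S \<inter> N5_orbit z = {z}" "\<And>v. v \<in> N5_orbit z \<Longrightarrow> cmod (fst z * snd z) \<le> cmod (fst v * snd v)"
proof -
  show z: "z \<in> H2" using assms by (auto simp: is_S5_def)
  then obtain w where w: "S \<inter> N5_orbit z = {w}"
    "\<forall>v \<in> N5_orbit z. cmod (fst w * snd w) \<le> cmod (fst v * snd v)"
    using assms by (auto simp: is_S5_def)
  have "z \<in> S \<inter> N5_orbit z" using N5_orbit_self assms(2) by blast
  then have "w = z" unfolding w(1) by simp
  then show "S \<inter> N5_orbit z = {z}" "\<And>v. v \<in> N5_orbit z \<Longrightarrow> cmod (fst z * snd z) \<le> cmod (fst v * snd v)"
    using w by auto
qed

text \<open>The heights are determined by c and t, and the real parts differ by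
  \<open>(f - e) / c\<close> and its conjugate, where \<open>(f - e) / c\<close> is integral for a
  unit c.\<close>

lemma elliptic_fixed_N5_orbit:
  assumes "z \<in> H2" "w \<in> H2" "c \<in> O5" "\<bar>c * K5_conj c\<bar> = 1" "e \<in> O5" "f \<in> O5"
    and z: "elliptic_fixed c e t z" and w: "elliptic_fixed c f t w"
  shows "w \<in> N5_orbit z"
proof -
  obtain k :: int where k: "c * K5_conj c = of_int k" using assms(3) by (rule K5_norm_int)
  have k1: "(of_int k :: real)\<^sup>2 = 1" using assms(4) unfolding k by (metis power2_abs one_power2)
  \<comment> \<open>The inverse of c: its conjugate times the norm, which is 1 or -1.\<close>
  define d where "d = of_int k * K5_conj c"
  have d: "d \<in> O5" "K5_conj d = of_int k * c"
    unfolding d_def using O5_mult[OF O5_of_int K5_conj_mem_O5[OF assms(3)], of k]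
    by (simp_all add: K5_conj_of_int K5_conj_K5_conj assms(3))
  have cd: "c * d = 1" "K5_conj c * K5_conj d = 1"
  proof -
    have *: "of_int k * (c * K5_conj c) = 1" using k1 unfolding k by (simp add: power2_eq_square)
    show "c * d = 1" using * unfolding d_def by (simp add: mult_ac)
    show "K5_conj c * K5_conj d = 1" using * unfolding d(2) by (simp add: mult_ac)
  qed
  have nz: "c \<noteq> 0" "K5_conj c \<noteq> 0" using cd by auto
  define \<nu> where "\<nu> = (f - e) * d"
  have \<nu>: "\<nu> \<in> O5" "K5_conj \<nu> = (K5_conj f - K5_conj e) * K5_conj d"
    unfolding \<nu>_def using assms d(1) by (simp_all add: O5_mult O5_diff)
  have "2 * c * (Re (fst w)) = 2 * c * (Re (fst z) + \<nu>)"
    using z w cd(1) unfolding elliptic_fixed_def \<nu>_def by algebra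
  then have r1: "Re (fst w) = Re (fst z) + \<nu>" using nz by simp
  have "2 * K5_conj c * (Re (snd w)) = 2 * K5_conj c * (Re (snd z) + K5_conj \<nu>)"
    using z w cd(2) unfolding elliptic_fixed_def \<nu>(2) by algebra
  then have r2: "Re (snd w) = Re (snd z) + K5_conj \<nu>" using nz by simp
  have "4 * c\<^sup>2 * (Im (fst w))\<^sup>2 = 4 * c\<^sup>2 * (Im (fst z))\<^sup>2"
    "4 * (K5_conj c)\<^sup>2 * (Im (snd w))\<^sup>2 = 4 * (K5_conj c)\<^sup>2 * (Im (snd z))\<^sup>2"
    using z w unfolding elliptic_fixed_def by simp_all
  then have "(Im (fst w))\<^sup>2 = (Im (fst z))\<^sup>2" "(Im (snd w))\<^sup>2 = (Im (snd z))\<^sup>2"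
    using nz by simp_all
  then have "Im (fst w) = Im (fst z)" "Im (snd w) = Im (snd z)"
    using assms(1,2) by (auto simp: H2_def power2_eq_iff)
  then have "w = (fst z + of_real \<nu>, snd z + of_real (K5_conj \<nu>))"
    using r1 r2 by (simp add: prod_eq_iff complex_eq_iff)
  then show ?thesis unfolding N5_orbit_def using \<nu>(1) by blast
qed

text \<open>Product and ratio keep \<open>y1\<close> away from 0: \<open>\<epsilon>^2 * y1^2\<close>
  is at least \<open>sqrt 5 / 4 > 1/2\<close> and \<open>\<epsilon>^2 \<le> 4\<close>, so
  \<open>y1^2 > 1/8\<close>. The proof settles for 1/9, a perfect square.\<close>

lemma U5_coordinate_bound:
  fixes c y1 y2 :: real
  assumes "0 < y1" "0 < y2" "y2 \<le> \<epsilon>\<^sup>2 * y1" "y1 * y2 = sqrt 5 / 4" "c\<^sup>2 * y1\<^sup>2 \<le> 1"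
  shows "\<bar>c\<bar> \<le> 3"
proof -
  have "sqrt 5 > 2" by (rule real_less_rsqrt) simp
  moreover have "\<epsilon>\<^sup>2 \<le> 4" using eps_square eps_less_2 by linarith
  moreover have "y1 * y2 \<le> y1 * (\<epsilon>\<^sup>2 * y1)" using assms by (intro mult_left_mono) auto
  moreover have "\<epsilon>\<^sup>2 * y1\<^sup>2 \<le> 4 * y1\<^sup>2" using \<open>\<epsilon>\<^sup>2 \<le> 4\<close> by (intro mult_right_mono) auto
  ultimately have "1 / 9 \<le> y1\<^sup>2" using assms(4) by (simp add: power2_eq_square mult_ac)
  then have "c\<^sup>2 * (1 / 9) \<le> c\<^sup>2 * y1\<^sup>2" by (intro mult_left_mono) auto
  then have "\<bar>c\<bar>\<^sup>2 \<le> 3\<^sup>2" using assms(5) by simp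
  then show ?thesis by (rule power2_le_imp_le) simp
qed

section \<open>Height bound, equality case and finiteness in Goetzky's domain\<close>

theorem theorem2p1:
  fixes S :: "(complex \<times> complex) set"
  assumes "is_S5 S"
  shows "(\<forall>z \<in> S \<inter> T5. Im (fst z) * Im (snd z) \<ge> sqrt 5 / 4)
    \<and> (\<forall>z \<in> Goetzky_domain S. Im (fst z) * Im (snd z) \<ge> sqrt 5 / 4)
    \<and> (\<forall>z \<in> Goetzky_domain S.
          Im (fst z) * Im (snd z) = sqrt 5 / 4 \<longleftrightarrow> special_elliptic_point z)
    \<and> finite {z \<in> Goetzky_domain S. special_elliptic_point z}"
proof -
  have main: "sqrt 5 / 4 \<le> Im (fst z) * Im (snd z)"
    "Im (fst z) * Im (snd z) = sqrt 5 / 4 \<longleftrightarrow> special_elliptic_point z" if z: "z \<in> S \<inter> T5" for z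
  proof -
    note zS = is_S5_minimal[OF assms, of z]
    have H: "z \<in> H2" using z zS by blast
    have "1 \<le> cmod (fst w * snd w)" if "w \<in> N5_orbit z" for w
      using zS(3)[OF _ that] z by (auto simp: T5_def)
    then have "\<not> (\<exists>w \<in> N5_orbit z. cmod (fst w * snd w) < 1)" by (meson not_less)
    \<comment> \<open>By minimality no translate has a product below 1, so only the exceptional case
      survives; the bound and both directions of the equivalence follow.\<close>
    then have low: "Im (fst z) * Im (snd z) \<le> sqrt 5 / 4 \<Longrightarrow>
        Im (fst z) * Im (snd z) = sqrt 5 / 4 \<and> special_elliptic_point z"
      using N5_orbit_below_1[OF H] by blast
    then show "sqrt 5 / 4 \<le> Im (fst z) * Im (snd z)" by linarith
    show "Im (fst z) * Im (snd z) = sqrt 5 / 4 \<longleftrightarrow> special_elliptic_point z"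
    proof
      assume "Im (fst z) * Im (snd z) = sqrt 5 / 4"
      then show "special_elliptic_point z" using low by simp
    next
      assume "special_elliptic_point z"
      then have "Im (fst z) * Im (snd z) \<le> sqrt 5 / 4"
        using special_elliptic_height_le H unfolding special_elliptic_point_iff[OF H] by blast
      then show "Im (fst z) * Im (snd z) = sqrt 5 / 4" using low by simp
    qed
  qed
  define C where "C = {c \<in> O5. \<bar>c\<bar> \<le> 3 \<and> \<bar>K5_conj c\<bar> \<le> 3}"
  \<comment> \<open>For p = (c, t) with c a unit, all these points lie in a single orbit, which
    meets \<open>S\<close> only once.\<close>
  define F where "F p = {z \<in> S. \<bar>fst p * K5_conj (fst p)\<bar> = 1 \<and> (\<exists>e \<in> O5. elliptic_fixed (fst p) e (snd p) z)}"
    for p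
  have "finite (F p)" if p: "p \<in> C \<times> {\<epsilon>, \<epsilon> - 1}" for p
  proof -
    have "z = w" if z: "z \<in> F p" and w: "w \<in> F p" for z w
    proof -
      have S: "z \<in> S" "w \<in> S" and unit: "\<bar>fst p * K5_conj (fst p)\<bar> = 1"
        using z w by (simp_all add: F_def)
      have c: "fst p \<in> O5" using p by (auto simp: C_def)
      obtain e f where "e \<in> O5" "f \<in> O5" "elliptic_fixed (fst p) e (snd p) z" "elliptic_fixed (fst p) f (snd p) w"
        using z w unfolding F_def by blast
      then have "w \<in> N5_orbit z"
        using elliptic_fixed_N5_orbit[OF is_S5_minimal(1)[OF assms S(1)] is_S5_minimal(1)[OF assms S(2)] c unit]
        by blast
      then have "w \<in> {z}" unfolding is_S5_minimal(2)[OF assms S(1), symmetric] using S by blast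
      then show ?thesis by simp
    qed
    then have "F p = {} \<or> (\<exists>z. F p = {z})" by blast
    then show ?thesis by auto
  qed
  moreover have "finite (C \<times> {\<epsilon>, \<epsilon> - 1})"
    unfolding C_def by (intro finite_cartesian_product finite_O5_bounded) simp
  ultimately have "finite (\<Union>p \<in> C \<times> {\<epsilon>, \<epsilon> - 1}. F p)"
    by (intro finite_UN_I)
  moreover have "{z \<in> Goetzky_domain S. special_elliptic_point z} \<subseteq> (\<Union>p \<in> C \<times> {\<epsilon>, \<epsilon> - 1}. F p)"
  proof
    fix z assume "z \<in> {z \<in> Goetzky_domain S. special_elliptic_point z}"
    then have S: "z \<in> S" "z \<in> S \<inter> T5" and U: "z \<in> U5" and sp: "special_elliptic_point z"
      by (auto simp: Goetzky_domain_def)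
    have H: "z \<in> H2" using S(1) is_S5_minimal(1)[OF assms] by blast
    obtain a c t where O: "a \<in> O5" "c \<in> O5" and t: "special_trace t" and fixed: "elliptic_fixed c a t z"
      using sp unfolding special_elliptic_point_iff[OF H] by blast
    have h: "Im (fst z) * Im (snd z) = sqrt 5 / 4" using main(2)[OF S(2)] sp by blast
    have y: "0 < Im (fst z)" "0 < Im (snd z)" using H by (auto simp: H2_def)
    \<comment> \<open>At the critical height the norm of c must be 1 or -1.\<close>
    have unit: "\<bar>c * K5_conj c\<bar> = 1"
      using elliptic_fixed_height(2)[OF O(2) t fixed H] unfolding h by simp
    have "Im (snd z) < \<epsilon>\<^sup>2 * Im (fst z)"
      using U y(1) by (simp add: U5_def pos_divide_less_eq)
    then have u2: "Im (snd z) \<le> \<epsilon>\<^sup>2 * Im (fst z)" by simp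
    have "inverse (\<epsilon>\<^sup>2) * Im (fst z) \<le> Im (snd z)"
      using U y(1) by (simp add: U5_def pos_le_divide_eq power_int_minus)
    then have u1: "Im (fst z) \<le> \<epsilon>\<^sup>2 * Im (snd z)"
      using eps_gt_1 by (simp add: inverse_eq_divide pos_divide_le_eq mult.commute)
    have b1: "c\<^sup>2 * (Im (fst z))\<^sup>2 \<le> 1" and b2: "(K5_conj c)\<^sup>2 * (Im (snd z))\<^sup>2 \<le> 1"
    proof -
      have "4 * c\<^sup>2 * (Im (fst z))\<^sup>2 = 4 - t\<^sup>2" "4 * (K5_conj c)\<^sup>2 * (Im (snd z))\<^sup>2 = 4 - (K5_conj t)\<^sup>2"
        using fixed by (simp_all add: elliptic_fixed_def)
      then show "c\<^sup>2 * (Im (fst z))\<^sup>2 \<le> 1" "(K5_conj c)\<^sup>2 * (Im (snd z))\<^sup>2 \<le> 1"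
        using zero_le_power2[of t] zero_le_power2[of "K5_conj t"] by linarith+
    qed
    have "\<bar>c\<bar> \<le> 3" by (rule U5_coordinate_bound[OF y u2 h b1])
    moreover have "\<bar>K5_conj c\<bar> \<le> 3"
      using h by (intro U5_coordinate_bound[OF y(2,1) u1 _ b2]) (simp add: mult.commute)
    ultimately have "c \<in> C" unfolding C_def using O by blast
    moreover have "z \<in> F (c, t)" unfolding F_def using S(1) unit O(1) fixed by auto
    ultimately show "z \<in> (\<Union>p \<in> C \<times> {\<epsilon>, \<epsilon> - 1}. F p)"
      using t by (auto simp: special_trace_def)
  qed
  ultimately have "finite {z \<in> Goetzky_domain S. special_elliptic_point z}"
    by (rule rev_finite_subset)
  moreover have "Goetzky_domain S \<subseteq> S \<inter> T5" by (auto simp: Goetzky_domain_def)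
  ultimately show ?thesis using main by blast
qed

end
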